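(* There is an algorithm that, given positive integers $B$ and $k$ and a graph $G=(V,E)$ with $n=|V|$ vertices, $m=|E|$ edges and maximum degree at most $B$, decides whether $G$ has a vertex cover with at most $m/B+k$ vertices in time $O(2^{kB}n^{O(1)})$. In particular, the problem Vertex Cover Above Tight Lower Bound-1 (VCL1), with parameters $k$ and $B$, is fixed-parameter tractable.
   Context: A vertex cover of a graph is a set of vertices containing at least one endpoint of every edge. VCL1: given a positive integer $B$, a graph $G$ with $m$ edges and maximum degree at most $B$, and a positive integer $k$, decide whether $G$ has a vertex cover of at most $m/B+k$ vertices; the parameters are $k$ and $B$. A parameterized problem is fixed-parameter tractable if it can be decided in time $f(\text{parameters})\cdot|I|^{O(1)}$ for a computable $f$. *)

theory Defs
  imports Complex_Main
begin

datatype instr =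
    LoadC nat nat
  | Add nat nat nat
  | Sub nat nat nat
  | LoadI nat nat
  | StoreI nat nat
  | Jz nat nat

type_synonym config = "nat \<times> (nat \<Rightarrow> nat)"

fun exec :: "instr \<Rightarrow> config \<Rightarrow> config" where
  "exec (LoadC r c) (pc, m) = (Suc pc, m(r := c))"
| "exec (Add r a b) (pc, m) = (Suc pc, m(r := m a + m b))"
| "exec (Sub r a b) (pc, m) = (Suc pc, m(r := m a - m b))"
| "exec (LoadI r a) (pc, m) = (Suc pc, m(r := m (m a)))"
| "exec (StoreI a r) (pc, m) = (Suc pc, m(m a := m r))"
| "exec (Jz r l) (pc, m) = (if m r = 0 then (l, m) else (Suc pc, m))"

definition step :: "instr list \<Rightarrow> config \<Rightarrow> config" where
  "step P c = (if fst c < length P then exec (P ! fst c) c else c)"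

definition halted :: "instr list \<Rightarrow> config \<Rightarrow> bool" where
  "halted P c \<longleftrightarrow> length P \<le> fst c"

definition init :: "nat list \<Rightarrow> config" where
  "init xs = (0, \<lambda>i. if i < length xs then xs ! i else 0)"

definition runs_within :: "instr list \<Rightarrow> nat list \<Rightarrow> nat \<Rightarrow> nat \<Rightarrow> bool" where
  "runs_within P xs t out \<longleftrightarrow>
     (\<exists>s\<le>t. halted P ((step P ^^ s) (init xs)) \<and> snd ((step P ^^ s) (init xs)) 0 = out)"

definition simple_graph :: "nat \<Rightarrow> nat set set \<Rightarrow> bool" where
  "simple_graph n E \<longleftrightarrow> (\<forall>e\<in>E. \<exists>u v. e = {u, v} \<and> u \<noteq> v \<and> u < n \<and> v < n)"

definition degree :: "nat set set \<Rightarrow> nat \<Rightarrow> nat" where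
  "degree E v = card {e \<in> E. v \<in> e}"

definition max_degree_le :: "nat \<Rightarrow> nat set set \<Rightarrow> nat \<Rightarrow> bool" where
  "max_degree_le n E B \<longleftrightarrow> (\<forall>v<n. degree E v \<le> B)"

definition vertex_cover :: "nat \<Rightarrow> nat set set \<Rightarrow> nat set \<Rightarrow> bool" where
  "vertex_cover n E C \<longleftrightarrow> C \<subseteq> {..<n} \<and> (\<forall>e\<in>E. e \<inter> C \<noteq> {})"

definition edge_list_of :: "(nat \<times> nat) list \<Rightarrow> nat set set \<Rightarrow> bool" where
  "edge_list_of es E \<longleftrightarrow>
     distinct (map (\<lambda>(u, v). {u, v}) es) \<and> set (map (\<lambda>(u, v). {u, v}) es) = E"

definition encode :: "nat \<Rightarrow> nat \<Rightarrow> nat \<Rightarrow> (nat \<times> nat) list \<Rightarrow> nat list" where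
  "encode B k n es = [B, k, n, length es] @ concat (map (\<lambda>(u, v). [u, v]) es)"

definition VCL1 :: "nat \<Rightarrow> nat \<Rightarrow> nat \<Rightarrow> nat set set \<Rightarrow> bool" where
  "VCL1 B k n E \<longleftrightarrow>
     (\<exists>C. vertex_cover n E C \<and> real (card C) \<le> real (card E) / real B + real k)"

end

theory Submission
  imports Defs
begin

text \<open>Every vertex covers at most \<open>B\<close> edges, so \<open>m/B\<close> is a lower bound already for the linear
  programming relaxation of vertex cover, and it suffices to solve vertex cover above that relaxation
  with excess \<open>k\<close>.  Take an uncovered edge.  If putting one of its ends into the cover does not
  increase the relaxed optimum, this is safe by Nemhauser--Trotter persistency.  Otherwise guess
  which end belongs to the cover: either choice costs at least 1/2 of the excess, so \<open>2 k\<close> guessed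
  bits suffice, and all \<open>4 ^ k\<close> strings of guesses are tried.  This is at most \<open>2 ^ (k B)\<close> if
  \<open>B \<ge> 2\<close>; if \<open>B = 1\<close> then \<open>m/B\<close> vertices are always enough.  The relaxation is
  solved by an auction algorithm for bipartite matching.\<close>

section \<open>A structured language and its compiler\<close>

text \<open>For a hypothetical cover \<open>S\<close> of the allowed size and the partial cover
  \<open>C\<close>, the search is governed by the number \<open>2 |S - C| - lam\<close>, where
  \<open>lam\<close> is twice the relaxed optimum after deleting \<open>C\<close>; the doubling
  keeps half-integral quantities in \<open>nat\<close>. The graph is stored as \<open>2 m\<close>
  arcs and each vertex of the double cover accounts for at most \<open>B\<close> of them, so
  \<open>2 m \<le> B * lam\<close> and the number starts at no more than \<open>2 k\<close>. A
  guessed vertex lowers the first term by 2 and \<open>lam\<close> by at most 1. A vertex accepted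
  by persistency lowers both by 2, possibly after exchanging \<open>S\<close>, and consumes no
  guess.

  Fixing the guesses in advance turns the recursive search into a single pass over the arc list, so
  nested loops suffice on a machine without a stack. By Koenig's theorem \<open>lam\<close> is the
  size of a maximum matching of the double cover; the auction finds it with one array of prices and
  one of partners. A further obstacle is that the input starts at address 0 and occupies the very
  registers that the program has to use.\<close>

text \<open>Commands act on variables and on arrays, all of type \<^typ>\<open>nat\<close>: \<open>Get x j y\<close> assigns
  element \<open>y\<close> of array \<open>j\<close> to \<open>x\<close>, \<open>Put j y x\<close> is the converse assignment, and \<open>Inp x y\<close> reads
  from a read-only memory \<open>w\<close>.  The last component of a state is a clock that bounds from above
  the number of machine steps of the compiled code.\<close>

datatype com =
    SetC nat nat
  | AddK nat nat nat
  | Plus nat nat nat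
  | Minus nat nat nat
  | Get nat nat nat
  | Put nat nat nat
  | Inp nat nat
  | Skip
  | Seq com com (infixr \<open>;;\<close> 60)
  | Cond nat com com
  | Loop nat com

type_synonym state = "(nat \<Rightarrow> nat) \<times> (nat \<Rightarrow> nat \<Rightarrow> nat) \<times> nat"

text \<open>A simple command is charged 7, the length of the longest translation: six instructions
  for an array address and one access. The 3 of \<open>Cond\<close> and \<open>Loop\<close> pays for
  the test and for the two instructions of an unconditional jump.\<close>

inductive run :: "(nat \<Rightarrow> nat option) \<Rightarrow> com \<Rightarrow> state \<Rightarrow> state \<Rightarrow> bool" for w where
  run_SetC: "run w (SetC x c) (v, a, t) (v(x := c), a, t + 7)"
| run_AddK: "run w (AddK x y c) (v, a, t) (v(x := v y + c), a, t + 7)"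
| run_Plus: "run w (Plus x y z) (v, a, t) (v(x := v y + v z), a, t + 7)"
| run_Minus: "run w (Minus x y z) (v, a, t) (v(x := v y - v z), a, t + 7)"
| run_Get: "run w (Get x j y) (v, a, t) (v(x := a j (v y)), a, t + 7)"
| run_Put: "run w (Put j y x) (v, a, t) (v, a(j := (a j)(v y := v x)), t + 7)"
| run_Inp: "w (v y) = Some c \<Longrightarrow> run w (Inp x y) (v, a, t) (v(x := c), a, t + 7)"
| run_Skip: "run w Skip s s"
| run_Seq: "run w c1 s1 s2 \<Longrightarrow> run w c2 s2 s3 \<Longrightarrow> run w (c1 ;; c2) s1 s3"
| run_CondT: "v x \<noteq> 0 \<Longrightarrow> run w c1 (v, a, t + 3) s' \<Longrightarrow> run w (Cond x c1 c2) (v, a, t) s'"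
| run_CondF: "v x = 0 \<Longrightarrow> run w c2 (v, a, t + 3) s' \<Longrightarrow> run w (Cond x c1 c2) (v, a, t) s'"
| run_LoopT: "v x \<noteq> 0 \<Longrightarrow> run w c (v, a, t + 3) s2 \<Longrightarrow> run w (Loop x c) s2 s3 \<Longrightarrow>
     run w (Loop x c) (v, a, t) s3"
| run_LoopF: "v x = 0 \<Longrightarrow> run w (Loop x c) (v, a, t) (v, a, t + 3)"

fun wf_com :: "com \<Rightarrow> bool" where
  "wf_com (SetC x c) \<longleftrightarrow> x < 40"
| "wf_com (AddK x y c) \<longleftrightarrow> x < 40 \<and> y < 40"
| "wf_com (Plus x y z) \<longleftrightarrow> x < 40 \<and> y < 40 \<and> z < 40"
| "wf_com (Minus x y z) \<longleftrightarrow> x < 40 \<and> y < 40 \<and> z < 40"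
| "wf_com (Get x j y) \<longleftrightarrow> x < 40 \<and> j < 8 \<and> y < 40"
| "wf_com (Put j y x) \<longleftrightarrow> x < 40 \<and> j < 8 \<and> y < 40"
| "wf_com (Inp x y) \<longleftrightarrow> x < 40 \<and> y < 40"
| "wf_com Skip \<longleftrightarrow> True"
| "wf_com (c1 ;; c2) \<longleftrightarrow> wf_com c1 \<and> wf_com c2"
| "wf_com (Cond x c1 c2) \<longleftrightarrow> x < 40 \<and> wf_com c1 \<and> wf_com c2"
| "wf_com (Loop x c) \<longleftrightarrow> x < 40 \<and> wf_com c"

text \<open>Variable \<open>x < 40\<close> lives in register \<open>x\<close>, registers 40 and 41 are scratch, and element \<open>i\<close> of
  array \<open>j < 8\<close> lives at address \<open>b + 8 * i + j\<close>, where register 42 holds the base address \<open>b\<close>; the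
  interleaving keeps unbounded arrays disjoint.\<close>

definition addr_code :: "nat \<Rightarrow> nat \<Rightarrow> instr list" where
  "addr_code j y = [Add 40 y y, Add 40 40 40, Add 40 40 40, Add 40 40 42, LoadC 41 j, Add 40 40 41]"

text \<open>Jumps of the machine are absolute, so \<open>p\<close> is the address at which the code
  will be placed. Clearing register 40 and testing it gives an unconditional jump.\<close>

fun compile :: "nat \<Rightarrow> com \<Rightarrow> instr list" where
  "compile p (SetC x c) = [LoadC x c]"
| "compile p (AddK x y c) = [LoadC 40 c, Add x y 40]"
| "compile p (Plus x y z) = [Add x y z]"
| "compile p (Minus x y z) = [Sub x y z]"
| "compile p (Get x j y) = addr_code j y @ [LoadI x 40]"
| "compile p (Put j y x) = addr_code j y @ [StoreI 40 x]"
| "compile p (Inp x y) = [LoadI x y]"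
| "compile p Skip = []"
| "compile p (c1 ;; c2) = (let k1 = compile p c1 in k1 @ compile (p + length k1) c2)"
| "compile p (Cond x c1 c2) =
     (let k1 = compile (p + 1) c1; q = p + length k1 + 3; k2 = compile q c2
      in [Jz x q] @ k1 @ [LoadC 40 0, Jz 40 (q + length k2)] @ k2)"
| "compile p (Loop x c) =
     (let k = compile (p + 1) c
      in [Jz x (p + length k + 3)] @ k @ [LoadC 40 0, Jz 40 p])"

section \<open>Simulation of commands by machine code\<close>

definition code_at :: "instr list \<Rightarrow> nat \<Rightarrow> instr list \<Rightarrow> bool" where
  "code_at P p k \<longleftrightarrow> (\<exists>xs ys. P = xs @ k @ ys \<and> length xs = p)"

lemma code_at_append: "code_at P p (k1 @ k2) \<longleftrightarrow> code_at P p k1 \<and> code_at P (p + length k1) k2"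
proof
  assume "code_at P p (k1 @ k2)"
  then obtain xs ys where P: "P = xs @ (k1 @ k2) @ ys" "length xs = p"
    unfolding code_at_def by blast
  then have "P = xs @ k1 @ (k2 @ ys)" "P = (xs @ k1) @ k2 @ ys" "length (xs @ k1) = p + length k1"
    by auto
  then show "code_at P p k1 \<and> code_at P (p + length k1) k2"
    unfolding code_at_def using P(2) by blast
next
  assume "code_at P p k1 \<and> code_at P (p + length k1) k2"
  then obtain xs ys xs' ys' where
    P: "P = xs @ k1 @ ys" "length xs = p" "P = xs' @ k2 @ ys'" "length xs' = p + length k1"
    unfolding code_at_def by blast
  then have "(xs @ k1) @ ys = xs' @ (k2 @ ys')" "length (xs @ k1) = length xs'"
    by auto
  then have "ys = k2 @ ys'"
    by (metis append_eq_append_conv)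
  with P show "code_at P p (k1 @ k2)"
    unfolding code_at_def by auto
qed

lemma code_at_Cons: "code_at P p (i # k) \<longleftrightarrow> (p < length P \<and> P ! p = i) \<and> code_at P (Suc p) k"
proof -
  have "code_at P p [i] \<longleftrightarrow> p < length P \<and> P ! p = i"
  proof
    assume "p < length P \<and> P ! p = i"
    then have "P = take p P @ [i] @ drop (Suc p) P" "length (take p P) = p"
      using id_take_nth_drop[of p P] by auto
    then show "code_at P p [i]" unfolding code_at_def by blast
  qed (auto simp: code_at_def)
  then show ?thesis using code_at_append[of P p "[i]" k] by simp
qed

lemma code_at_step: "p < length P \<and> P ! p = i \<Longrightarrow> step P (p, mem) = exec i (p, mem)"
  by (simp add: step_def)

text \<open>The saved input lies between the registers and the array base held in register 42. No
  command writes there, so \<open>w\<close> stays valid throughout a run.\<close>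

definition rep :: "(nat \<Rightarrow> nat option) \<Rightarrow> (nat \<Rightarrow> nat) \<Rightarrow> (nat \<Rightarrow> nat \<Rightarrow> nat) \<Rightarrow> (nat \<Rightarrow> nat) \<Rightarrow> bool" where
  "rep w v a mem \<longleftrightarrow>
     (\<forall>x<40. mem x = v x) \<and> 43 \<le> mem 42 \<and>
     (\<forall>j<8. \<forall>i. mem (mem 42 + 8 * i + j) = a j i) \<and>
     (\<forall>p c. w p = Some c \<longrightarrow> 43 \<le> p \<and> p < mem 42 \<and> mem p = c)"

lemma rep_scratch: "rep w v a mem \<Longrightarrow> r = 40 \<or> r = 41 \<Longrightarrow> rep w v a (mem(r := c))"
  by (auto simp: rep_def) (force+)

lemma rep_var: "rep w v a mem \<Longrightarrow> x < 40 \<Longrightarrow> rep w (v(x := c)) a (mem(x := c))"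
  by (auto simp: rep_def) (force+)

lemma rep_array:
  assumes "rep w v a mem" "j < 8"
  shows "rep w v (a(j := (a j)(i := c))) (mem(mem 42 + 8 * i + j := c))"
proof -
  have inj: "8 * i' + j' = 8 * i + j \<longleftrightarrow> i' = i \<and> j' = j" if "j' < 8" for i' j' :: nat
  proof
    assume eq: "8 * i' + j' = 8 * i + j"
    have "i' = (8 * i' + j') div 8" "i = (8 * i + j) div 8" using that assms(2) by auto
    then show "i' = i \<and> j' = j" using eq by auto
  qed simp
  let ?p = "mem 42 + 8 * i + j"
  have big: "43 \<le> ?p" "mem 42 \<le> ?p" using assms unfolding rep_def by auto
  then have ne: "x \<noteq> ?p" if "x < 43 \<or> x < mem 42" for x using that by linarith
  show ?thesis
    unfolding rep_def
  proof (intro conjI allI impI)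
    fix j' i' :: nat assume "j' < 8"
    moreover have "(mem 42 + 8 * i' + j' = ?p) \<longleftrightarrow> 8 * i' + j' = 8 * i + j" by linarith
    ultimately show "(mem(?p := c)) ((mem(?p := c)) 42 + 8 * i' + j') = (a(j := (a j)(i := c))) j' i'"
      using assms inj[of j' i'] ne[of 42] unfolding rep_def by auto
  qed (use assms ne in \<open>auto simp: rep_def\<close>)
qed

definition reach :: "instr list \<Rightarrow> nat \<Rightarrow> config \<Rightarrow> config \<Rightarrow> bool" where
  "reach P T c c' \<longleftrightarrow> (\<exists>s\<le>T. (step P ^^ s) c = c')"

lemma reach_refl: "reach P 0 c c"
  by (simp add: reach_def)

lemma reach_trans: "reach P S c c' \<Longrightarrow> reach P T c' c'' \<Longrightarrow> reach P (S + T) c c''"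
  unfolding reach_def
proof (elim exE conjE)
  fix s s' assume "s \<le> S" "(step P ^^ s) c = c'" "s' \<le> T" "(step P ^^ s') c' = c''"
  then show "\<exists>u\<le>S + T. (step P ^^ u) c = c''"
    by (intro exI[of _ "s' + s"]) (simp add: funpow_add)
qed

lemma reach_step: "reach P T (step P c) c' \<Longrightarrow> reach P (Suc T) c c'"
  unfolding reach_def by (metis Suc_le_mono comp_apply funpow_Suc_right)

lemma reach_mono: "reach P S c c' \<Longrightarrow> S \<le> T \<Longrightarrow> reach P T c c'"
  unfolding reach_def using le_trans by blast

lemma reach_exec:
  "p < length P \<and> P ! p = i \<Longrightarrow> reach P T (exec i (p, mem)) c' \<Longrightarrow> reach P (Suc T) (p, mem) c'"
  by (simp add: code_at_step reach_step)

lemma length_addr_code [simp]: "length (addr_code j y) = 6"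
  by (simp add: addr_code_def)

lemma addr_code_reach:
  assumes "code_at P p (addr_code j y)" "rep w v a mem" "y < 40"
  shows "\<exists>mem'. reach P 6 (p, mem) (p + 6, mem') \<and> rep w v a mem' \<and> mem' 40 = mem' 42 + 8 * v y + j"
proof -
  let ?m = "mem(41 := j, 40 := mem 42 + 8 * v y + j)"
  have m: "mem y = v y" using assms by (auto simp: rep_def)
  have "(step P ^^ Suc (Suc (Suc (Suc (Suc (Suc 0)))))) (p, mem) = (p + 6, ?m)"
    using assms(1) unfolding addr_code_def code_at_Cons funpow_Suc_right
    by (simp add: step_def m) (auto simp: fun_eq_iff)
  then have "reach P 6 (p, mem) (p + 6, ?m)"
    unfolding reach_def by (intro exI[of _ 6]) (simp add: eval_nat_numeral)
  moreover have "rep w v a ?m" using assms(2) by (intro rep_scratch) auto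
  ultimately show ?thesis by (intro exI[of _ ?m]) auto
qed


lemma rep_simps:
  assumes "rep w v a mem"
  shows "x < 40 \<Longrightarrow> mem x = v x" and "j < 8 \<Longrightarrow> mem (mem 42 + 8 * i + j) = a j i"
    and "w q = Some c \<Longrightarrow> mem q = c"
  using assms by (auto simp: rep_def)

lemma reach_one:
  "p < length P \<and> P ! p = i \<Longrightarrow> reach P 1 (p, mem) (exec i (p, mem))"
  using reach_exec[of p P i 0 mem] reach_refl by simp

lemma reach_jump:
  assumes "code_at P p [LoadC 40 0, Jz 40 q]"
  shows "reach P 2 (p, mem) (q, mem(40 := 0))"
proof -
  have "reach P 1 (p, mem) (Suc p, mem(40 := 0))"
    using reach_one[of p P "LoadC 40 0" mem] assms by (simp add: code_at_Cons)
  moreover have "reach P 1 (Suc p, mem(40 := 0)) (q, mem(40 := 0))"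
    using reach_one[of "Suc p" P "Jz 40 q" "mem(40 := 0)"] assms by (simp add: code_at_Cons)
  ultimately show ?thesis using reach_trans[of P 1 _ _ 1] by (simp add: numeral_2_eq_2)
qed

text \<open>The number \<open>T\<close> of machine steps fits into the increase of the clock, so all
  cost analysis can be done on commands.\<close>

lemma comp_correct:
  "run w c s s' \<Longrightarrow> wf_com c \<Longrightarrow> code_at P p (compile p c) \<Longrightarrow> rep w (fst s) (fst (snd s)) mem \<Longrightarrow>
   \<exists>T mem'. reach P T (p, mem) (p + length (compile p c), mem') \<and> snd (snd s) + T \<le> snd (snd s') \<and>
     rep w (fst s') (fst (snd s')) mem'"
proof (induction arbitrary: p mem rule: run.induct)
  case (run_SetC x c v a t)
  then have "reach P 1 (p, mem) (Suc p, mem(x := c))"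
    using reach_one[of p P "LoadC x c" mem] by (simp add: code_at_Cons)
  moreover have "rep w (v(x := c)) a (mem(x := c))" using run_SetC by (intro rep_var) auto
  ultimately show ?case by (intro exI[of _ 1] exI[of _ "mem(x := c)"]) (simp add: fun_upd_def)
next
  case (run_AddK x y c v a t)
  let ?m = "mem(40 := c)"
  have r1: "reach P 1 (p, mem) (Suc p, ?m)"
    using reach_one[of p P "LoadC 40 c" mem] run_AddK.prems by (simp add: code_at_Cons)
  have rep1: "rep w v a ?m" using run_AddK.prems by (intro rep_scratch) auto
  have r2: "reach P 1 (Suc p, ?m) (Suc (Suc p), ?m(x := v y + c))"
    using reach_one[of "Suc p" P "Add x y 40" ?m] run_AddK.prems rep_simps(1)[OF rep1, of y]
    by (simp add: code_at_Cons)
  have "rep w (v(x := v y + c)) a (?m(x := v y + c))"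
    using run_AddK.prems rep1 by (intro rep_var) auto
  with reach_trans[OF r1 r2] show ?case
    by (intro exI[of _ "1 + 1"] exI[of _ "?m(x := v y + c)"]) (simp add: fun_upd_def)
next
  case (run_Plus x y z v a t)
  have "reach P 1 (p, mem) (Suc p, mem(x := v y + v z))"
    using reach_one[of p P "Add x y z" mem] run_Plus by (simp add: code_at_Cons rep_simps)
  moreover have "rep w (v(x := v y + v z)) a (mem(x := v y + v z))"
    using run_Plus by (intro rep_var) auto
  ultimately show ?case by (intro exI[of _ 1] exI[of _ "mem(x := v y + v z)"]) (simp add: fun_upd_def)
next
  case (run_Minus x y z v a t)
  have "reach P 1 (p, mem) (Suc p, mem(x := v y - v z))"
    using reach_one[of p P "Sub x y z" mem] run_Minus by (simp add: code_at_Cons rep_simps)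
  moreover have "rep w (v(x := v y - v z)) a (mem(x := v y - v z))"
    using run_Minus by (intro rep_var) auto
  ultimately show ?case by (intro exI[of _ 1] exI[of _ "mem(x := v y - v z)"]) (simp add: fun_upd_def)
next
  case (run_Get x j y v a t)
  then have "code_at P p (addr_code j y)" "code_at P (p + 6) [LoadI x 40]"
    by (auto simp: code_at_append)
  moreover have "rep w v a mem" "y < 40" "x < 40" "j < 8" using run_Get.prems by auto
  ultimately obtain m' where r1: "reach P 6 (p, mem) (p + 6, m')" and rep': "rep w v a m'"
    and m': "m' 40 = m' 42 + 8 * v y + j"
    using addr_code_reach by meson
  have r2: "reach P 1 (p + 6, m') (Suc (p + 6), m'(x := a j (v y)))"
    using reach_one[of "p + 6" P "LoadI x 40" m'] \<open>code_at P (p + 6) _\<close> m'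
      rep_simps(2)[OF rep' \<open>j < 8\<close>, of "v y"] by (simp add: code_at_Cons)
  have "rep w (v(x := a j (v y))) a (m'(x := a j (v y)))"
    using rep' \<open>x < 40\<close> by (intro rep_var) auto
  with reach_trans[OF r1 r2] show ?case
    by (intro exI[of _ "6 + 1"] exI[of _ "m'(x := a j (v y))"]) (simp add: fun_upd_def add.commute)
next
  case (run_Put j y x v a t)
  then have "code_at P p (addr_code j y)" "code_at P (p + 6) [StoreI 40 x]"
    by (auto simp: code_at_append)
  moreover have "rep w v a mem" "y < 40" "x < 40" "j < 8" using run_Put.prems by auto
  ultimately obtain m' where r1: "reach P 6 (p, mem) (p + 6, m')" and rep': "rep w v a m'"
    and m': "m' 40 = m' 42 + 8 * v y + j"
    using addr_code_reach by meson
  let ?m = "m'(m' 42 + 8 * v y + j := v x)"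
  have r2: "reach P 1 (p + 6, m') (Suc (p + 6), ?m)"
    using reach_one[of "p + 6" P "StoreI 40 x" m'] \<open>code_at P (p + 6) _\<close> m'
      rep_simps(1)[OF rep' \<open>x < 40\<close>] by (simp add: code_at_Cons)
  have "rep w v (a(j := (a j)(v y := v x))) ?m"
    using rep_array[OF rep' \<open>j < 8\<close>] .
  with reach_trans[OF r1 r2] show ?case
    by (intro exI[of _ "6 + 1"] exI[of _ ?m]) (simp add: fun_upd_def add.commute)
next
  case (run_Inp v y c x a t)
  then have "mem y = v y" "mem (v y) = c" using rep_simps by auto
  then have "reach P 1 (p, mem) (Suc p, mem(x := c))"
    using reach_one[of p P "LoadI x y" mem] run_Inp by (simp add: code_at_Cons)
  moreover have "rep w (v(x := c)) a (mem(x := c))" using run_Inp by (intro rep_var) auto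
  ultimately show ?case by (intro exI[of _ 1] exI[of _ "mem(x := c)"]) (simp add: fun_upd_def)
next
  case (run_Skip s)
  then show ?case using reach_refl by (intro exI[of _ 0] exI[of _ mem]) auto
next
  case (run_Seq c1 s1 s2 c2 s3)
  let ?q = "p + length (compile p c1)"
  have c: "code_at P p (compile p c1)" "code_at P ?q (compile ?q c2)"
    using run_Seq.prems by (auto simp: Let_def code_at_append)
  obtain T1 m1 where 1: "reach P T1 (p, mem) (?q, m1)" "snd (snd s1) + T1 \<le> snd (snd s2)"
    "rep w (fst s2) (fst (snd s2)) m1"
    using run_Seq.IH(1)[OF _ c(1) run_Seq.prems(3)] run_Seq.prems(1) by auto
  obtain T2 m2 where 2: "reach P T2 (?q, m1) (?q + length (compile ?q c2), m2)"
    "snd (snd s2) + T2 \<le> snd (snd s3)" "rep w (fst s3) (fst (snd s3)) m2"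
    using run_Seq.IH(2)[OF _ c(2) 1(3)] run_Seq.prems(1) by auto
  show ?case
    using reach_trans[OF 1(1) 2(1)] 1(2) 2(2,3)
    by (intro exI[of _ "T1 + T2"] exI[of _ m2]) (simp add: Let_def add.assoc)
next
  case (run_CondT v x c1 a t s' c2)
  let ?k = "compile (p + 1) c1"
  let ?q = "p + length ?k + 3"
  have "code_at P p ([Jz x ?q] @ ?k @ [LoadC 40 0, Jz 40 (?q + length (compile ?q c2))] @ compile ?q c2)"
    using run_CondT.prems by (simp add: Let_def)
  then have c: "p < length P \<and> P ! p = Jz x ?q" "code_at P (p + 1) ?k"
    "code_at P (p + 1 + length ?k) [LoadC 40 0, Jz 40 (?q + length (compile ?q c2))]"
    unfolding code_at_append by (simp_all add: code_at_Cons[of _ _ "Jz x _"])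
  have "mem x = v x" using run_CondT.prems rep_simps by auto
  then have r1: "reach P 1 (p, mem) (p + 1, mem)"
    using reach_one[OF c(1), of mem] run_CondT.hyps by simp
  obtain T m1 where r2: "reach P T (p + 1, mem) (p + 1 + length ?k, m1)" "t + 3 + T \<le> snd (snd s')"
    "rep w (fst s') (fst (snd s')) m1"
    using run_CondT.IH[OF _ c(2), of mem] run_CondT.prems(1,3) by auto
  note r = reach_trans[OF reach_trans[OF r1 r2(1)] reach_jump[OF c(3)]]
  show ?case
    using r r2(2) rep_scratch[OF r2(3), of 40 0]
    by (intro exI[of _ "1 + T + 2"] exI[of _ "m1(40 := 0)"]) (simp add: Let_def add_ac fun_upd_def numeral_3_eq_3)
next
  case (run_CondF v x c2 a t s' c1)
  let ?k = "compile (p + 1) c1"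
  let ?q = "p + length ?k + 3"
  have "code_at P p ([Jz x ?q] @ ?k @ [LoadC 40 0, Jz 40 (?q + length (compile ?q c2))] @ compile ?q c2)"
    using run_CondF.prems by (simp add: Let_def)
  then have c: "p < length P \<and> P ! p = Jz x ?q" "code_at P ?q (compile ?q c2)"
    unfolding code_at_append code_at_Cons by (simp_all add: algebra_simps code_at_Cons eval_nat_numeral)
  have "mem x = v x" using run_CondF.prems rep_simps by auto
  then have r1: "reach P 1 (p, mem) (?q, mem)"
    using reach_one[OF c(1), of mem] run_CondF.hyps by simp
  obtain T m1 where r2: "reach P T (?q, mem) (?q + length (compile ?q c2), m1)" "t + 3 + T \<le> snd (snd s')"
    "rep w (fst s') (fst (snd s')) m1"
    using run_CondF.IH[OF _ c(2), of mem] run_CondF.prems(1,3) by auto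
  show ?case
    using reach_trans[OF r1 r2(1)] r2(2,3)
    by (intro exI[of _ "1 + T"] exI[of _ m1]) (simp add: Let_def add_ac fun_upd_def numeral_3_eq_3)
next
  case (run_LoopT v x c a t s2 s3)
  let ?k = "compile (p + 1) c"
  have "code_at P p ([Jz x (p + length ?k + 3)] @ ?k @ [LoadC 40 0, Jz 40 p])"
    using run_LoopT.prems by (simp add: Let_def)
  then have c: "p < length P \<and> P ! p = Jz x (p + length ?k + 3)" "code_at P (p + 1) ?k"
    "code_at P (p + 1 + length ?k) [LoadC 40 0, Jz 40 p]"
    unfolding code_at_append by (simp_all add: code_at_Cons[of _ _ "Jz x _"])
  have "mem x = v x" using run_LoopT.prems rep_simps by auto
  then have r1: "reach P 1 (p, mem) (p + 1, mem)"
    using reach_one[OF c(1), of mem] run_LoopT.hyps by simp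
  obtain T m1 where r2: "reach P T (p + 1, mem) (p + 1 + length ?k, m1)" "t + 3 + T \<le> snd (snd s2)"
    "rep w (fst s2) (fst (snd s2)) m1"
    using run_LoopT.IH(1)[OF _ c(2), of mem] run_LoopT.prems(1,3) by auto
  obtain T' m2 where r3: "reach P T' (p, m1(40 := 0)) (p + length (compile p (Loop x c)), m2)"
    "snd (snd s2) + T' \<le> snd (snd s3)" "rep w (fst s3) (fst (snd s3)) m2"
    using run_LoopT.IH(2)[OF run_LoopT.prems(1,2) rep_scratch[OF r2(3), of 40 0]]
    by (auto simp: fun_upd_def)
  note r = reach_trans[OF reach_trans[OF reach_trans[OF r1 r2(1)] reach_jump[OF c(3)]] r3(1)]
  show ?case
    using r r2(2) r3(2,3)
    by (intro exI[of _ "1 + T + 2 + T'"] exI[of _ m2]) (simp add: fun_upd_def)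
next
  case (run_LoopF v x c a t)
  let ?k = "compile (p + 1) c"
  have c: "p < length P \<and> P ! p = Jz x (p + length ?k + 3)"
    using run_LoopF.prems by (simp add: Let_def code_at_append code_at_Cons)
  have "mem x = v x" using run_LoopF.prems rep_simps by auto
  then have "reach P 1 (p, mem) (p + length ?k + 3, mem)"
    using reach_one[OF c(1), of mem] run_LoopF.hyps by simp
  then show ?case
    using run_LoopF.prems by (intro exI[of _ 1] exI[of _ mem]) (simp add: Let_def add_ac fun_upd_def numeral_3_eq_3)
qed

section \<open>Weakest preconditions\<close>

text \<open>A run exists only if all loops terminate and every \<open>Inp\<close> stays within the
  domain of \<open>w\<close>; this is therefore total correctness, with the clock visible to the
  postcondition.\<close>

definition wp :: "(nat \<Rightarrow> nat option) \<Rightarrow> com \<Rightarrow> ((nat \<Rightarrow> nat) \<Rightarrow> (nat \<Rightarrow> nat \<Rightarrow> nat) \<Rightarrow> nat \<Rightarrow> bool) \<Rightarrow>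
    (nat \<Rightarrow> nat) \<Rightarrow> (nat \<Rightarrow> nat \<Rightarrow> nat) \<Rightarrow> nat \<Rightarrow> bool" where
  "wp w c Q v a t \<longleftrightarrow> (\<exists>v' a' t'. run w c (v, a, t) (v', a', t') \<and> Q v' a' t')"

inductive_cases run_SetCE: "run w (SetC x c) s s'"
inductive_cases run_AddKE: "run w (AddK x y c) s s'"
inductive_cases run_PlusE: "run w (Plus x y z) s s'"
inductive_cases run_MinusE: "run w (Minus x y z) s s'"
inductive_cases run_GetE: "run w (Get x j y) s s'"
inductive_cases run_PutE: "run w (Put j y x) s s'"
inductive_cases run_SkipE: "run w Skip s s'"
inductive_cases run_SeqE: "run w (c1 ;; c2) s s'"
inductive_cases run_CondE: "run w (Cond x c1 c2) s s'"

lemma wp_simps [simp]: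
  "wp w (SetC x c) Q v a t \<longleftrightarrow> Q (v(x := c)) a (t + 7)"
  "wp w (AddK x y c) Q v a t \<longleftrightarrow> Q (v(x := v y + c)) a (t + 7)"
  "wp w (Plus x y z) Q v a t \<longleftrightarrow> Q (v(x := v y + v z)) a (t + 7)"
  "wp w (Minus x y z) Q v a t \<longleftrightarrow> Q (v(x := v y - v z)) a (t + 7)"
  "wp w (Get x j y) Q v a t \<longleftrightarrow> Q (v(x := a j (v y))) a (t + 7)"
  "wp w (Put j y x) Q v a t \<longleftrightarrow> Q v (a(j := (a j)(v y := v x))) (t + 7)"
  "wp w Skip Q v a t \<longleftrightarrow> Q v a t"
  unfolding wp_def
  by (auto elim!: run_SetCE run_AddKE run_PlusE run_MinusE run_GetE run_PutE run_SkipE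
      intro!: exI intro: run.intros)

lemma wp_Inp: "w (v y) = Some c \<Longrightarrow> Q (v(x := c)) a (t + 7) \<Longrightarrow> wp w (Inp x y) Q v a t"
  unfolding wp_def by (blast intro: run_Inp)

lemma wp_Seq [simp]: "wp w (c1 ;; c2) Q = wp w c1 (wp w c2 Q)"
  unfolding wp_def by (intro ext) (fastforce elim!: run_SeqE intro: run_Seq)

lemma wp_Cond [simp]:
  "wp w (Cond x c1 c2) Q v a t \<longleftrightarrow>
     (if v x \<noteq> 0 then wp w c1 Q v a (t + 3) else wp w c2 Q v a (t + 3))"
  unfolding wp_def by (auto elim!: run_CondE intro: run_CondT run_CondF)

lemma wp_conseq:
  "wp w c Q v a t \<Longrightarrow> (\<And>v' a' t'. Q v' a' t' \<Longrightarrow> Q' v' a' t') \<Longrightarrow> wp w c Q' v a t"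
  unfolding wp_def by blast

section \<open>Frame conditions and loop rules\<close>

fun mod_vars :: "com \<Rightarrow> nat set" where
  "mod_vars (SetC x c) = {x}"
| "mod_vars (AddK x y c) = {x}"
| "mod_vars (Plus x y z) = {x}"
| "mod_vars (Minus x y z) = {x}"
| "mod_vars (Get x j y) = {x}"
| "mod_vars (Put j y x) = {}"
| "mod_vars (Inp x y) = {x}"
| "mod_vars Skip = {}"
| "mod_vars (c1 ;; c2) = mod_vars c1 \<union> mod_vars c2"
| "mod_vars (Cond x c1 c2) = mod_vars c1 \<union> mod_vars c2"
| "mod_vars (Loop x c) = mod_vars c"

fun mod_arrays :: "com \<Rightarrow> nat set" where
  "mod_arrays (Put j y x) = {j}"
| "mod_arrays (c1 ;; c2) = mod_arrays c1 \<union> mod_arrays c2"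
| "mod_arrays (Cond x c1 c2) = mod_arrays c1 \<union> mod_arrays c2"
| "mod_arrays (Loop x c) = mod_arrays c"
| "mod_arrays _ = {}"

definition agree :: "com \<Rightarrow> (nat \<Rightarrow> nat) \<Rightarrow> (nat \<Rightarrow> nat \<Rightarrow> nat) \<Rightarrow> (nat \<Rightarrow> nat) \<Rightarrow> (nat \<Rightarrow> nat \<Rightarrow> nat) \<Rightarrow> bool" where
  "agree c v a v' a' \<longleftrightarrow> (\<forall>x. x \<notin> mod_vars c \<longrightarrow> v' x = v x) \<and> (\<forall>j. j \<notin> mod_arrays c \<longrightarrow> a' j = a j)"

lemma run_agree:
  "run w c s s' \<Longrightarrow> agree c (fst s) (fst (snd s)) (fst s') (fst (snd s'))"
  by (induction rule: run.induct) (auto simp: agree_def)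

text \<open>Whatever a command does not syntactically assign is preserved. Loop invariants thus have
  to mention only what changes.\<close>

lemma wp_agree:
  "wp w c Q v a t \<Longrightarrow> wp w c (\<lambda>v' a' t'. Q v' a' t' \<and> agree c v a v' a') v a t"
  unfolding wp_def using run_agree by fastforce

text \<open>The measure \<open>\<mu>\<close> yields termination only; running time is carried by the
  invariant \<open>I\<close>, which sees the clock.\<close>

lemma wp_Loop:
  fixes \<mu> :: "(nat \<Rightarrow> nat) \<Rightarrow> (nat \<Rightarrow> nat \<Rightarrow> nat) \<Rightarrow> nat"
  assumes init: "I v a t"
    and step: "\<And>v' a' t'. I v' a' t' \<Longrightarrow> agree c v a v' a' \<Longrightarrow> v' b \<noteq> 0 \<Longrightarrow>
      wp w c (\<lambda>v'' a'' t''. I v'' a'' t'' \<and> \<mu> v'' a'' < \<mu> v' a') v' a' (t' + 3)"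
    and exit: "\<And>v' a' t'. I v' a' t' \<Longrightarrow> agree c v a v' a' \<Longrightarrow> v' b = 0 \<Longrightarrow> Q v' a' (t' + 3)"
  shows "wp w (Loop b c) Q v a t"
proof -
  have "wp w (Loop b c) Q v' a' t'" if "I v' a' t'" "agree c v a v' a'" for v' a' t'
    using that
  proof (induction "\<mu> v' a'" arbitrary: v' a' t' rule: less_induct)
    case less
    show ?case
    proof (cases "v' b = 0")
      case True
      then show ?thesis using exit[OF less.prems True] unfolding wp_def by (blast intro: run_LoopF)
    next
      case False
      from wp_agree[OF step[OF less.prems False]]
      obtain v2 a2 t2 where r: "run w c (v', a', t' + 3) (v2, a2, t2)"
        and *: "I v2 a2 t2" "\<mu> v2 a2 < \<mu> v' a'" "agree c v' a' v2 a2"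
        unfolding wp_def by blast
      have "agree c v a v2 a2" using *(3) less.prems(2) by (auto simp: agree_def)
      from less.hyps[OF *(2,1) this] r False show ?thesis
        unfolding wp_def by (blast intro: run_LoopT)
    qed
  qed
  then show ?thesis using init by (simp add: agree_def)
qed

text \<open>Only tests for zero exist, so \<open>b\<close> holds the number \<open>N - i\<close> of
  iterations still to come.\<close>

definition For :: "nat \<Rightarrow> nat \<Rightarrow> nat \<Rightarrow> com \<Rightarrow> com" where
  "For i b N c = SetC i 0 ;; AddK b N 0 ;; Loop b (c ;; AddK i i 1 ;; Minus b N i)"

lemma For_simps [simp]:
  "mod_vars (For i b N c) = insert i (insert b (mod_vars c))"
  "mod_arrays (For i b N c) = mod_arrays c"
  "wf_com (For i b N c) \<longleftrightarrow> i < 40 \<and> b < 40 \<and> N < 40 \<and> wf_com c"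
  by (auto simp: For_def)

text \<open>An iteration costs the body plus 3 for the test and 14 for the two counter updates; the
  initial assignments and the final test cost 17 once. \<open>stable\<close> asks that the invariant
  be insensitive to the counters, which the loop itself overwrites.\<close>

lemma wp_For:
  assumes fresh: "i \<noteq> b" "i \<noteq> N" "b \<noteq> N" "i \<notin> mod_vars c" "b \<notin> mod_vars c" "N \<notin> mod_vars c"
    and init: "I 0 v a"
    and step: "\<And>j v' a' t'. j < v N \<Longrightarrow> v' i = j \<Longrightarrow> agree (For i b N c) v a v' a' \<Longrightarrow> I j v' a' \<Longrightarrow>
      wp w c (\<lambda>v'' a'' t''. I (Suc j) v'' a'' \<and> t'' \<le> t' + K) v' a' t'"
    and stable: "\<And>j v a x y. I j v a \<Longrightarrow> I j (v(i := x, b := y)) a"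
    and exit: "\<And>v' a' t'. I (v N) v' a' \<Longrightarrow> agree (For i b N c) v a v' a' \<Longrightarrow>
      t' \<le> t + 17 + v N * (K + 17) \<Longrightarrow> Q v' a' t'"
  shows "wp w (For i b N c) Q v a t"
proof -
  define J where "J v' a' t' \<longleftrightarrow> v' i \<le> v N \<and> v' b = v N - v' i \<and> agree (For i b N c) v a v' a' \<and>
    I (v' i) v' a' \<and> t' \<le> t + 14 + v' i * (K + 17)" for v' a' t'
  have "wp w (Loop b (c ;; AddK i i 1 ;; Minus b N i)) Q (v(i := 0, b := v N)) a (t + 14)"
  proof (rule wp_Loop[where I = J and \<mu> = "\<lambda>v a. v b"])
    show "J (v(i := 0, b := v N)) a (t + 14)"
      using fresh init stable[of 0 v a 0 "v N"] by (auto simp: J_def agree_def)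
  next
    fix v' a' t'
    assume J: "J v' a' t'" and b: "v' b \<noteq> 0"
    from J have ag: "agree (For i b N c) v a v' a'" by (simp add: J_def)
    have lt: "v' i < v N" using J b by (simp add: J_def)
    have "wp w c (\<lambda>v'' a'' t''. I (Suc (v' i)) v'' a'' \<and> t'' \<le> t' + 3 + K) v' a' (t' + 3)"
      by (rule step) (use J lt in \<open>auto simp: J_def\<close>)
    from wp_agree[OF this]
    show "wp w (c ;; AddK i i 1 ;; Minus b N i)
      (\<lambda>v'' a'' t''. J v'' a'' t'' \<and> v'' b < v' b) v' a' (t' + 3)"
      unfolding wp_Seq
    proof (rule wp_conseq, elim conjE)
      fix v'' a'' t''
      assume I: "I (Suc (v' i)) v'' a''" and t: "t'' \<le> t' + 3 + K" and ag': "agree c v' a' v'' a''"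
      let ?v = "v''(i := v'' i + 1, b := v'' N - Suc (v'' i))"
      have eq: "v'' i = v' i" "v'' N = v N"
        using ag ag' fresh by (auto simp: agree_def)
      have "I (Suc (v' i)) ?v a''" using stable[OF I] by simp
      moreover have "agree (For i b N c) v a ?v a''"
        using ag ag' by (auto simp: agree_def)
      ultimately have "J ?v a'' (t'' + 14)"
        using eq fresh lt t J by (auto simp: J_def)
      then show "wp w (AddK i i 1) (wp w (Minus b N i)
          (\<lambda>v'' a'' t''. J v'' a'' t'' \<and> v'' b < v' b)) v'' a'' t''"
        using fresh eq lt J by (auto simp: J_def add.commute)
    qed
  next
    fix v' a' t'
    assume J: "J v' a' t'" and "v' b = 0"
    then have "v' i = v N" by (simp add: J_def)
    then show "Q v' a' (t' + 3)" using J by (intro exit) (auto simp: J_def)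
  qed
  then show ?thesis using fresh by (simp add: For_def add.commute)
qed

section \<open>The half-integral relaxation of vertex cover\<close>

text \<open>\<open>dcover n A C X Y\<close>: the pair \<open>(X, Y)\<close> is a vertex cover of the bipartite double cover of the
  graph with arcs \<open>A\<close> after deleting \<open>C\<close>.  Hence \<open>lam n A C\<close> is twice the optimum of the linear
  programming relaxation of vertex cover on that graph.\<close>

definition dcover :: "nat \<Rightarrow> (nat \<times> nat) set \<Rightarrow> nat set \<Rightarrow> nat set \<Rightarrow> nat set \<Rightarrow> bool" where
  "dcover n A C X Y \<longleftrightarrow> X \<subseteq> {..<n} - C \<and> Y \<subseteq> {..<n} - C \<and>
     (\<forall>(u, w)\<in>A. u \<notin> C \<longrightarrow> w \<notin> C \<longrightarrow> u \<in> X \<or> w \<in> Y)"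

definition lam :: "nat \<Rightarrow> (nat \<times> nat) set \<Rightarrow> nat set \<Rightarrow> nat" where
  "lam n A C = (LEAST s. \<exists>X Y. dcover n A C X Y \<and> s = card X + card Y)"

lemma lam_le: "dcover n A C X Y \<Longrightarrow> lam n A C \<le> card X + card Y"
  unfolding lam_def by (rule Least_le) blast

lemma dcoverD:
  assumes "dcover n A C X Y"
  shows "finite X" "finite Y" "X \<inter> C = {}" "Y \<inter> C = {}" "X \<subseteq> {..<n}" "Y \<subseteq> {..<n}"
    and "(u, w) \<in> A \<Longrightarrow> u \<notin> C \<Longrightarrow> w \<notin> C \<Longrightarrow> u \<in> X \<or> w \<in> Y"
  using assms unfolding dcover_def by (auto intro: finite_subset[of _ "{..<n} - C"])

definition arcs_ok :: "nat \<Rightarrow> (nat \<times> nat) set \<Rightarrow> bool" where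
  "arcs_ok n A \<longleftrightarrow> A \<subseteq> {..<n} \<times> {..<n} \<and> sym A"

definition covers :: "nat \<Rightarrow> (nat \<times> nat) set \<Rightarrow> nat set \<Rightarrow> bool" where
  "covers n A S \<longleftrightarrow> S \<subseteq> {..<n} \<and> (\<forall>(u, w)\<in>A. u \<in> S \<or> w \<in> S)"

lemma lam_attained:
  assumes "arcs_ok n A"
  obtains X Y where "dcover n A C X Y" "lam n A C = card X + card Y"
proof -
  have "dcover n A C ({..<n} - C) ({..<n} - C)"
    using assms by (auto simp: dcover_def arcs_ok_def)
  then have "\<exists>s X Y. dcover n A C X Y \<and> s = card X + card Y" by blast
  then have "\<exists>X Y. dcover n A C X Y \<and> lam n A C = card X + card Y"
    unfolding lam_def by (rule LeastI_ex)
  then show ?thesis using that by blast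
qed

lemma lam_le_cover:
  assumes "covers n A S"
  shows "lam n A C \<le> 2 * card (S - C)"
proof -
  have "dcover n A C (S - C) (S - C)"
    using assms by (auto simp: dcover_def covers_def)
  from lam_le[OF this] show ?thesis by simp
qed

text \<open>Nemhauser--Trotter persistency.  With \<open>P\<close> and \<open>Q\<close> the sets of vertices of value at least
  1/2 and exactly 1 in an optimal relaxed solution, replace \<open>S\<close> by \<open>C \<union> Q \<union> (S \<inter> P)\<close>; were it
  larger, shifting by 1/2 along \<open>S\<close> would improve the optimum.\<close>

lemma persistency:
  assumes A: "arcs_ok n A" and S: "covers n A S" "C \<subseteq> S" and u: "u < n" "u \<notin> C"
    and drop: "lam n A (insert u C) + 2 \<le> lam n A C"
  obtains S' where "covers n A S'" "insert u C \<subseteq> S'" "card S' \<le> card S"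
proof -
  obtain X0 Y0 where D0: "dcover n A (insert u C) X0 Y0" "lam n A (insert u C) = card X0 + card Y0"
    using lam_attained[OF A] by blast
  define P where "P = insert u (X0 \<union> Y0)"
  define Q where "Q = insert u (X0 \<inter> Y0)"
  note d0 = dcoverD[OF D0(1)]
  have uX: "u \<notin> X0" "u \<notin> Y0" using d0 by auto
  have finP: "finite P" and finQ: "finite Q" using d0 by (auto simp: P_def Q_def)
  have fS: "finite S" and Sn: "S \<subseteq> {..<n}" using S by (auto simp: covers_def intro: finite_subset)
  have disj: "P \<inter> C = {}" "Q \<inter> C = {}" "Q \<subseteq> P" "P \<subseteq> {..<n}" using d0 u by (auto simp: P_def Q_def)
  have "card P + card Q = card X0 + card Y0 + 2"
    using uX d0 card_Un_Int[of X0 Y0] by (simp add: P_def Q_def)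
  \<comment> \<open>Passing from \<open>(X0, Y0)\<close> to \<open>(P, Q)\<close> adds
    \<open>u\<close> on both sides; the assumed drop by 2 pays for this, so \<open>(P, Q)\<close>
    costs no more than the optimum.\<close>
  then have PQ: "card P + card Q \<le> lam n A C" using D0(2) drop by simp
  \<comment> \<open>A neighbour of a vertex of value 0 has value 1.\<close>
  have key: "b \<in> Q" if "(a, b) \<in> A" "a \<notin> C" "b \<notin> C" "a \<notin> P" for a b
  proof (cases "b = u")
    case False
    have "(b, a) \<in> A" using A that(1) by (auto simp: arcs_ok_def dest: symD)
    then have "b \<in> X0" "b \<in> Y0"
      using d0(7)[of a b] d0(7)[of b a] that False by (auto simp: P_def)
    then show ?thesis by (simp add: Q_def)
  qed (simp add: Q_def)
  define T where "T = S - C - P"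
  have fT: "finite T" using fS by (simp add: T_def)
  \<comment> \<open>The shift: vertices of \<open>S - C\<close> of value 0 rise to 1/2, vertices of
    value 1 outside \<open>S\<close> fall to 1/2. Optimality then says that the latter are no more
    numerous than the former.\<close>
  have "dcover n A C (P \<union> T) (Q \<inter> S)"
    unfolding dcover_def
  proof (intro conjI ballI)
    fix e assume "e \<in> A"
    then show "case e of (a, b) \<Rightarrow> a \<notin> C \<longrightarrow> b \<notin> C \<longrightarrow> a \<in> P \<union> T \<or> b \<in> Q \<inter> S"
      using key S(1) by (fastforce simp: T_def covers_def)
  qed (use disj Sn in \<open>auto simp: T_def\<close>)
  from lam_le[OF this] have "card P + card Q \<le> card (P \<union> T) + card (Q \<inter> S)" using PQ by simp
  moreover have "card (P \<union> T) = card P + card T"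
    by (rule card_Un_disjoint) (use finP fT in \<open>auto simp: T_def\<close>)
  moreover have "card Q = card (Q \<inter> S) + card (Q - S)"
    using finQ by (subst card_Un_disjoint[symmetric]) (auto intro: arg_cong[where f = card])
  ultimately have QT: "card (Q - S) \<le> card T" by linarith
  let ?S = "(S - T) \<union> (Q - S)"
  have "card ?S \<le> card (S - T) + card (Q - S)" by (rule card_Un_le)
  also have "\<dots> \<le> card (S - T) + card T" using QT by simp
  also have "\<dots> = card S"
    using fS by (subst card_Un_disjoint[symmetric]) (auto simp: T_def intro: arg_cong[where f = card])
  finally have card: "card ?S \<le> card S" .
  have "(a \<in> ?S \<or> b \<in> ?S)" if ab: "(a, b) \<in> A" for a b
  proof -
    have ba: "(b, a) \<in> A" using A ab by (auto simp: arcs_ok_def dest: symD)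
    have "a \<in> S \<or> b \<in> S" using S(1) ab by (auto simp: covers_def)
    then show ?thesis using key[OF ab] key[OF ba] S(2) disj by (auto simp: T_def)
  qed
  then have "covers n A ?S" using Sn disj by (auto simp: covers_def)
  moreover have "insert u C \<subseteq> ?S" using S(2) by (auto simp: T_def P_def Q_def)
  ultimately show ?thesis using that card by blast
qed

section \<open>Search along a string of guesses\<close>

text \<open>The guess \<open>x < N = 2 ^ R\<close> is read bit by bit from the top by doubling.\<close>

fun solve :: "nat \<Rightarrow> (nat \<times> nat) set \<Rightarrow> nat \<Rightarrow> (nat \<times> nat) list \<Rightarrow> nat set \<Rightarrow> nat \<Rightarrow> nat set" where
  "solve n A N [] C x = C"
| "solve n A N ((u, w) # as) C x =
     (if u \<in> C \<or> w \<in> C then solve n A N as C x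
      else if lam n A (insert u C) + 2 \<le> lam n A C then solve n A N as (insert u C) x
      else if lam n A (insert w C) + 2 \<le> lam n A C then solve n A N as (insert w C) x
      else if N \<le> 2 * x then solve n A N as (insert u C) (2 * x - N)
      else solve n A N as (insert w C) (2 * x))"

text \<open>Every guess, right or wrong, leads to a cover. A wrong guess can only make it too large
  and never causes a false acceptance.\<close>

lemma solve_covers:
  assumes "C \<subseteq> {..<n}" "set as \<subseteq> {..<n} \<times> {..<n}"
  shows "C \<subseteq> solve n A N as C x \<and> covers n (set as) (solve n A N as C x)"
  using assms
proof (induction as arbitrary: C x)
  case (Cons e as)
  obtain u w where e: "e = (u, w)" by force
  have "C \<subseteq> solve n A N as C' y \<and> covers n (set (e # as)) (solve n A N as C' y)"
    if "C \<subseteq> C'" "C' \<subseteq> {..<n}" "u \<in> C' \<or> w \<in> C'" for C' y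
  proof -
    have "C' \<subseteq> solve n A N as C' y" "covers n (set as) (solve n A N as C' y)"
      using Cons.IH[of C' y] Cons.prems that by auto
    then show ?thesis using that by (auto simp: covers_def e)
  qed
  note good = this
  have uw: "u < n" "w < n" using Cons.prems by (auto simp: e)
  then have u: "C \<subseteq> solve n A N as (insert u C) y \<and> covers n (set (e # as)) (solve n A N as (insert u C) y)"
    and w: "C \<subseteq> solve n A N as (insert w C) y \<and> covers n (set (e # as)) (solve n A N as (insert w C) y)" for y
    using Cons.prems(1) good[of "insert u C" y] good[of "insert w C" y] by (simp_all add: subset_insertI)
  have c: "C \<subseteq> solve n A N as C y \<and> covers n (set (e # as)) (solve n A N as C y)"
    if "u \<in> C \<or> w \<in> C" for y
    using that Cons.prems(1) good[of C y] by simp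
  show ?case using u w c unfolding e by simp
qed (simp add: covers_def)

text \<open>\<open>r\<close> bounds the doubled excess \<open>2 * card (S - C) - lam n A C\<close>
  and is the number of bits still to be guessed. These bits form \<open>y\<close>; the factor
  \<open>2 ^ (R - r)\<close> moves them to the top of an \<open>R\<close>-bit word, where
  \<open>solve\<close> reads next. The cover \<open>S\<close> varies in the induction because
  persistency exchanges it.\<close>

lemma solve_good:
  assumes A: "arcs_ok n A" and "covers n A S" "C \<subseteq> S" "set as \<subseteq> A" "r \<le> R"
    and "2 * card (S - C) \<le> r + lam n A C"
  shows "\<exists>y<2 ^ r. card (solve n A (2 ^ R) as C (2 ^ (R - r) * y)) \<le> card S"
  using assms(2-)
proof (induction as arbitrary: C S r)
  case Nil
  then have "finite S" by (auto simp: covers_def intro: finite_subset)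
  then have "card C \<le> card S" using Nil.prems by (intro card_mono)
  then show ?case by (intro exI[of _ 0]) simp
next
  case (Cons e as)
  obtain u w where e: "e = (u, w)" by force
  have uw: "u < n" "w < n" "(u, w) \<in> A" using Cons.prems A by (auto simp: e arcs_ok_def)
  have fin: "finite S" using Cons.prems by (auto simp: covers_def intro: finite_subset)
  then have finC: "finite C" using Cons.prems(2) by (rule rev_finite_subset)
  have diff: "card (S' - insert z C) + 1 = card (S' - C)"
    if "z \<in> S'" "z \<notin> C" "finite S'" for z S'
  proof -
    have "card (S' - C) = card (insert z (S' - insert z C))"
      using that by (intro arg_cong[where f = card]) auto
    also have "\<dots> = Suc (card (S' - insert z C))"
      by (rule card_insert_disjoint) (use that in auto)
    finally show ?thesis by simp
  qed
  have dropped: "\<exists>y<2 ^ r. card (solve n A (2 ^ R) as (insert z C) (2 ^ (R - r) * y)) \<le> card S"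
    if z: "z < n" "z \<notin> C" "lam n A (insert z C) + 2 \<le> lam n A C" for z
  proof -
    obtain S' where S': "covers n A S'" "insert z C \<subseteq> S'" "card S' \<le> card S"
      using persistency[OF A Cons.prems(1,2) z] by blast
    have fin': "finite S'" using S' by (auto simp: covers_def intro: finite_subset)
    have "card (S' - C) \<le> card (S - C)"
      using S' Cons.prems(2) finC by (simp add: card_Diff_subset)
    moreover have "card (S' - insert z C) + 1 = card (S' - C)" using diff z S' fin' by blast
    \<comment> \<open>Adding \<open>z\<close> on both sides repairs a double cover of the smaller
      graph. The optimum therefore falls by exactly 2, and the excess does not grow.\<close>
    moreover have "lam n A C \<le> lam n A (insert z C) + 2"
    proof -
      obtain X Y where XY: "dcover n A (insert z C) X Y" "lam n A (insert z C) = card X + card Y"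
        using lam_attained[OF A] by blast
      note d = dcoverD[OF XY(1)]
      have "dcover n A C (insert z X) (insert z Y)"
        unfolding dcover_def using d z by auto
      from lam_le[OF this] XY d show ?thesis by simp
    qed
    ultimately have "2 * card (S' - insert z C) \<le> r + lam n A (insert z C)"
      using Cons.prems(5) by linarith
    from Cons.IH[OF S'(1,2) _ Cons.prems(4) this] Cons.prems(3)
    obtain y where "y < 2 ^ r" "card (solve n A (2 ^ R) as (insert z C) (2 ^ (R - r) * y)) \<le> card S'"
      by auto
    then show ?thesis using S'(3) by (intro exI[of _ y]) linarith
  qed
  \<comment> \<open>A failed test means that the optimum falls by at most 1, while the doubled size
    of the rest of \<open>S\<close> falls by 2. Since the new optimum does not exceed this doubled
    size, a bit was still available.\<close>
  have branch: "r \<ge> 1 \<and> 2 * card (S - insert z C) \<le> (r - 1) + lam n A (insert z C)"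
    if z: "z \<in> S" "z \<notin> C" "\<not> lam n A (insert z C) + 2 \<le> lam n A C" for z
    using diff[OF z(1,2) fin] z(3) Cons.prems(5) lam_le_cover[OF Cons.prems(1), of "insert z C"]
    by linarith
  consider (cov) "u \<in> C \<or> w \<in> C"
    | (u) "u \<notin> C" "w \<notin> C" "lam n A (insert u C) + 2 \<le> lam n A C"
    | (w) "u \<notin> C" "w \<notin> C" "\<not> lam n A (insert u C) + 2 \<le> lam n A C" "lam n A (insert w C) + 2 \<le> lam n A C"
    | (br) "u \<notin> C" "w \<notin> C" "\<not> lam n A (insert u C) + 2 \<le> lam n A C" "\<not> lam n A (insert w C) + 2 \<le> lam n A C"
    by blast
  then show ?case
  proof cases
    case cov
    then show ?thesis using Cons.IH[OF Cons.prems(1,2) _ Cons.prems(4,5)] Cons.prems(3) by (simp add: e)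
  next
    case u
    then show ?thesis using dropped[OF uw(1)] by (simp add: e)
  next
    case w
    then show ?thesis using dropped[OF uw(2)] by (simp add: e)
  next
    case br
    define q where "q = r - 1"
    define D where "D = (2::nat) ^ (R - r)"
    have step: "\<exists>y<2 ^ q. card (solve n A (2 ^ R) as (insert z C) (2 ^ (R - q) * y)) \<le> card S \<and> r = Suc q"
      if z: "z \<in> S" "z = u \<or> z = w" for z
    proof -
      have b: "r \<ge> 1" "2 * card (S - insert z C) \<le> q + lam n A (insert z C)"
        using branch[OF z(1)] z(2) br by (auto simp: q_def)
      have "set as \<subseteq> A" "insert z C \<subseteq> S" "q \<le> R" using Cons.prems z by (auto simp: q_def)
      from Cons.IH[OF Cons.prems(1) this(2,1,3) b(2)] b(1) show ?thesis by (auto simp: q_def)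
    qed
    have pow: "2 ^ (R - q) = 2 * D" "2 ^ R = 2 * D * 2 ^ q" if "r = Suc q"
    proof -
      have 1: "R - q = Suc (R - r)" and 2: "Suc (R - r) + q = R" using that Cons.prems(4) by auto
      show "2 ^ (R - q) = 2 * D" unfolding 1 D_def by simp
      have "2 ^ (Suc (R - r) + q) = 2 * D * 2 ^ q" unfolding D_def power_add by simp
      then show "2 ^ R = 2 * D * 2 ^ q" unfolding 2 .
    qed
    have "u \<in> S \<or> w \<in> S" using Cons.prems(1) uw by (auto simp: covers_def)
    then show ?thesis
    proof
      assume "u \<in> S"
      from step[OF this] obtain y where y: "y < 2 ^ q" "r = Suc q"
        "card (solve n A (2 ^ R) as (insert u C) (2 ^ (R - q) * y)) \<le> card S" by auto
      note p = pow[OF y(2)]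
      \<comment> \<open>A leading bit 1 selects \<open>u\<close>: doubling carries it to
        \<open>2 ^ R\<close>, and the subtraction leaves the other bits at the top.\<close>
      have "2 * (D * (2 ^ q + y)) - 2 ^ R = 2 ^ (R - q) * y" "2 ^ R \<le> 2 * (D * (2 ^ q + y))"
        unfolding p by (simp_all add: algebra_simps)
      then have "solve n A (2 ^ R) (e # as) C (D * (2 ^ q + y)) =
          solve n A (2 ^ R) as (insert u C) (2 ^ (R - q) * y)"
        using br by (simp add: e)
      moreover have "2 ^ q + y < 2 ^ r" using y(1,2) by simp
      ultimately show ?thesis using y(3) unfolding D_def by (intro exI[of _ "2 ^ q + y"]) simp
    next
      assume "w \<in> S"
      from step[OF this] obtain y where y: "y < 2 ^ q" "r = Suc q"
        "card (solve n A (2 ^ R) as (insert w C) (2 ^ (R - q) * y)) \<le> card S" by auto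
      note p = pow[OF y(2)]
      have "\<not> 2 ^ R \<le> 2 * (D * y)"
        unfolding p using y(1) by (simp add: D_def)
      then have "solve n A (2 ^ R) (e # as) C (D * y) = solve n A (2 ^ R) as (insert w C) (2 * D * y)"
        using br by (simp add: e mult.assoc)
      then have "solve n A (2 ^ R) (e # as) C (D * y) =
          solve n A (2 ^ R) as (insert w C) (2 ^ (R - q) * y)" unfolding p(1) .
      moreover have "y < 2 ^ r" using y(1,2) by simp
      ultimately show ?thesis using y(3) unfolding D_def by (intro exI[of _ y]) simp
    qed
  qed
qed

section \<open>Auction algorithm for matchings of the double cover\<close>

text \<open>An auction for a maximum matching of the double cover: a free left vertex bids for the
  neighbour of least price \<open>D\<close>, evicts its partner \<open>M\<close> (stored with offset 1, so that 0 means
  unmatched) and increments the price; it gives up once all neighbours cost at least \<open>n\<close>.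
  Deleted vertices have price \<open>n\<close>.  \<open>L\<close> is the set of left vertices that are settled.\<close>

definition auction_state :: "nat \<Rightarrow> (nat \<times> nat) set \<Rightarrow> nat set \<Rightarrow> nat set \<Rightarrow> (nat \<Rightarrow> nat) \<Rightarrow> (nat \<Rightarrow> nat) \<Rightarrow> bool" where
  "auction_state n A C L D M \<longleftrightarrow>
     (\<forall>v<n. D v \<le> n) \<and> (\<forall>v<n. v \<in> C \<longrightarrow> D v = n \<and> M v = 0) \<and>
     (\<forall>v<n. v \<notin> C \<longrightarrow> (M v = 0 \<longleftrightarrow> D v = 0)) \<and>
     (\<forall>v<n. \<forall>u. M v = Suc u \<longrightarrow> u \<in> L \<and> (u, v) \<in> A \<and> (\<forall>z. (u, z) \<in> A \<longrightarrow> D v \<le> Suc (D z))) \<and>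
     (\<forall>v<n. \<forall>z<n. M v = M z \<longrightarrow> M v \<noteq> 0 \<longrightarrow> v = z) \<and>
     (\<forall>u\<in>L. (\<exists>v<n. M v = Suc u) \<or> (\<forall>z. (u, z) \<in> A \<longrightarrow> n \<le> D z))"

lemma auction_stateD:
  assumes "auction_state n A C L D M" and v: "v < n"
  shows "D v \<le> n" "v \<in> C \<Longrightarrow> D v = n" "v \<in> C \<Longrightarrow> M v = 0" "v \<notin> C \<Longrightarrow> M v = 0 \<longleftrightarrow> D v = 0"
    and "M v = Suc u \<Longrightarrow> u \<in> L" "M v = Suc u \<Longrightarrow> (u, v) \<in> A"
    and "M v = Suc u \<Longrightarrow> (u, z) \<in> A \<Longrightarrow> D v \<le> Suc (D z)"
    and "z < n \<Longrightarrow> M v = M z \<Longrightarrow> M v \<noteq> 0 \<Longrightarrow> v = z"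
proof -
  note st = assms(1)[unfolded auction_state_def]
  show "D v \<le> n" by (rule st[THEN conjunct1, rule_format, OF v])
  show "v \<in> C \<Longrightarrow> D v = n" by (rule st[THEN conjunct2, THEN conjunct1, THEN spec, THEN mp, THEN mp, OF v, THEN conjunct1])
  show "v \<in> C \<Longrightarrow> M v = 0" by (rule st[THEN conjunct2, THEN conjunct1, THEN spec, THEN mp, THEN mp, OF v, THEN conjunct2])
  show "v \<notin> C \<Longrightarrow> M v = 0 \<longleftrightarrow> D v = 0" by (rule st[THEN conjunct2, THEN conjunct2, THEN conjunct1, rule_format, OF v])
  note m = st[THEN conjunct2, THEN conjunct2, THEN conjunct2, THEN conjunct1, THEN spec, THEN mp, OF v]
  show "M v = Suc u \<Longrightarrow> u \<in> L" "M v = Suc u \<Longrightarrow> (u, v) \<in> A"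
    "M v = Suc u \<Longrightarrow> (u, z) \<in> A \<Longrightarrow> D v \<le> Suc (D z)"
    using m by blast+
  show "z < n \<Longrightarrow> M v = M z \<Longrightarrow> M v \<noteq> 0 \<Longrightarrow> v = z" by (rule st[THEN conjunct2, THEN conjunct2, THEN conjunct2, THEN conjunct2, THEN conjunct1, rule_format, OF v])
qed

lemma auction_stateD':
  assumes "auction_state n A C L D M" "u \<in> L"
  shows "(\<exists>v<n. M v = Suc u) \<or> (\<forall>z. (u, z) \<in> A \<longrightarrow> n \<le> D z)"
  using assms unfolding auction_state_def by (elim conjE) (rule bspec)

definition matched :: "nat \<Rightarrow> (nat \<Rightarrow> nat) \<Rightarrow> nat set" where
  "matched n M = {v. v < n \<and> M v \<noteq> 0}"

text \<open>Weak duality gives one inequality.  For the other, one of the \<open>n + 1\<close> prices is not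
  attained by \<open>D\<close>; the right vertices above such a gap together with the left vertices matched
  below it form a double cover with as many vertices as there are matched pairs.\<close>

lemma auction_lam:
  assumes A: "arcs_ok n A" and st: "auction_state n A C ({..<n} - C) D M"
  shows "card (matched n M) = lam n A C"
proof (rule antisym)
  let ?L = "\<lambda>v. M v - 1"
  have inj: "inj_on ?L (matched n M)"
  proof (rule inj_onI)
    fix v z assume "v \<in> matched n M" "z \<in> matched n M" "?L v = ?L z"
    then have "v < n" "z < n" "M v = M z" "M v \<noteq> 0" by (auto simp: matched_def)
    then show "v = z" using auction_stateD(8)[OF st] by blast
  qed
  have fin: "finite (matched n M)" by (simp add: matched_def)
  have live: "v \<notin> C \<and> ?L v < n \<and> ?L v \<notin> C \<and> (?L v, v) \<in> A \<and> (\<forall>z. (?L v, z) \<in> A \<longrightarrow> D v \<le> Suc (D z))"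
    if m: "v \<in> matched n M" for v
  proof -
    obtain u where u: "M v = Suc u" "v < n" using m by (auto simp: matched_def gr0_conv_Suc)
    then have "u \<in> {..<n} - C" "(u, v) \<in> A" "\<forall>z. (u, z) \<in> A \<longrightarrow> D v \<le> Suc (D z)"
      using auction_stateD(5-7)[OF st u(2,1)] by blast+
    moreover have "v \<notin> C" using auction_stateD(3)[OF st u(2)] u(1) by auto
    ultimately show ?thesis using u by simp
  qed
  obtain X Y where XY: "dcover n A C X Y" "lam n A C = card X + card Y"
    using lam_attained[OF A] by blast
  note d = dcoverD[OF XY(1)]
  \<comment> \<open>Weak duality: a matched pair whose right end is outside \<open>Y\<close> has its
    left end in \<open>X\<close>, and left ends are distinct.\<close>
  have "?L ` (matched n M - Y) \<subseteq> X" using live d(7) by blast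
  then have "card (matched n M - Y) \<le> card X"
    by (intro card_inj_on_le[of ?L]) (use inj d(1) in \<open>auto intro: inj_on_subset\<close>)
  moreover have "card (matched n M) \<le> card (matched n M - Y) + card Y"
  proof -
    have "card (matched n M) \<le> card ((matched n M - Y) \<union> Y)" using fin d(2) by (intro card_mono) auto
    also have "\<dots> \<le> card (matched n M - Y) + card Y" by (rule card_Un_le)
    finally show ?thesis .
  qed
  ultimately show "card (matched n M) \<le> lam n A C" using XY(2) by linarith
next
  let ?L = "\<lambda>v. M v - 1"
  let ?V = "{..<n} - C"
  have "card (D ` ?V) < card {..n}"
    using card_image_le[of ?V D] card_mono[of "{..<n}" ?V] by auto
  then have "\<not> {..n} \<subseteq> D ` ?V"
    using card_mono[of "D ` ?V" "{..n}"] by auto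
  then obtain g where g: "g \<le> n" "g \<notin> D ` ?V" by auto
  define Y where "Y = {v \<in> ?V. g < D v}"
  define Z where "Z = {v \<in> matched n M. D v < g}"
  have eq: "matched n M = Y \<union> Z"
  proof -
    have 1: "v \<in> matched n M" if "v \<in> Y" for v
      using that auction_stateD(4)[OF st, of v] by (auto simp: Y_def matched_def)
    have 2: "v \<in> ?V" if "v \<in> matched n M" for v
      using that auction_stateD(3)[OF st, of v] by (auto simp: matched_def)
    have "v \<in> Y \<union> Z" if "v \<in> matched n M" for v
    proof -
      have "D v \<noteq> g" using g(2) 2[OF that] by auto
      then show ?thesis using 2[OF that] that unfolding Y_def Z_def by auto
    qed
    then show ?thesis using 1 by (auto simp: Z_def)
  qed
  have "dcover n A C (?L ` Z) Y"
    unfolding dcover_def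
  proof (intro conjI ballI)
    show "?L ` Z \<subseteq> ?V"
    proof
      fix u assume "u \<in> ?L ` Z"
      then obtain v where "M v = Suc u" "v < n" by (auto simp: Z_def matched_def)
      then show "u \<in> ?V" using auction_stateD(5)[OF st] by blast
    qed
    fix e assume eA: "e \<in> A"
    obtain u z where e: "e = (u, z)" by force
    have "u \<in> ?L ` Z \<or> z \<in> Y" if "u \<notin> C" "z \<notin> C"
    proof -
      have u: "u \<in> ?V" "z \<in> ?V" using that eA A by (auto simp: e arcs_ok_def)
      then have gz: "D z \<noteq> g" using g(2) by auto
      consider v where "v < n" "M v = Suc u" | "n \<le> D z"
        using auction_stateD'[OF st u(1)] eA unfolding e by blast
      then show ?thesis
      proof cases
        case (1 v)
        then have v: "v \<in> matched n M" "v \<in> ?V" using auction_stateD(3)[OF st 1(1)] by (auto simp: matched_def)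
        show ?thesis
        proof (cases "v \<in> Z")
          case True
          then show ?thesis using 1 by (auto intro: rev_image_eqI)
        next
          case False
          then have "g < D v" using v eq by (auto simp: Y_def)
          \<comment> \<open>The gap absorbs the slack of 1: \<open>g < D v \<le> D z + 1\<close>
            gives \<open>g \<le> D z\<close>, and no undeleted vertex has price
            \<open>g\<close>.\<close>
          moreover have "D v \<le> Suc (D z)" using auction_stateD(7)[OF st 1] eA unfolding e by blast
          ultimately show ?thesis using gz u by (auto simp: Y_def)
        qed
      qed (use g(1) gz u in \<open>auto simp: Y_def\<close>)
    qed
    then show "case e of (u, w) \<Rightarrow> u \<notin> C \<longrightarrow> w \<notin> C \<longrightarrow> u \<in> ?L ` Z \<or> w \<in> Y" by (simp add: e)
  qed (auto simp: Y_def)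
  from lam_le[OF this] have "lam n A C \<le> card (?L ` Z) + card Y" .
  also have "\<dots> \<le> card Z + card Y"
    using card_image_le[of Z ?L] by (simp add: Z_def matched_def)
  also have "\<dots> = card (matched n M)"
    unfolding eq by (subst card_Un_disjoint) (auto simp: Y_def Z_def matched_def)
  finally show "lam n A C \<le> card (matched n M)" .
qed

lemma auction_stateI:
  assumes "\<And>v. v < n \<Longrightarrow> D v \<le> n" "\<And>v. v < n \<Longrightarrow> v \<in> C \<Longrightarrow> D v = n \<and> M v = 0"
    and "\<And>v. v < n \<Longrightarrow> v \<notin> C \<Longrightarrow> M v = 0 \<longleftrightarrow> D v = 0"
    and "\<And>v u. v < n \<Longrightarrow> M v = Suc u \<Longrightarrow> u \<in> L \<and> (u, v) \<in> A \<and> (\<forall>z. (u, z) \<in> A \<longrightarrow> D v \<le> Suc (D z))"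
    and "\<And>v z. v < n \<Longrightarrow> z < n \<Longrightarrow> M v = M z \<Longrightarrow> M v \<noteq> 0 \<Longrightarrow> v = z"
    and "\<And>u. u \<in> L \<Longrightarrow> (\<exists>v<n. M v = Suc u) \<or> (\<forall>z. (u, z) \<in> A \<longrightarrow> n \<le> D z)"
  shows "auction_state n A C L D M"
  unfolding auction_state_def using assms by (intro conjI allI ballI impI) blast+

text \<open>A bidder all of whose neighbours cost at least \<open>n\<close> meets the second
  alternative demanded of settled vertices, and nothing else changes.\<close>

lemma auction_discard:
  assumes st: "auction_state n A C (G - {u}) D M" and u: "\<And>z. (u, z) \<in> A \<Longrightarrow> n \<le> D z"
    and "u \<in> G"
  shows "auction_state n A C G D M"
proof (rule auction_stateI)
  fix v assume v: "v < n"
  note d = auction_stateD[OF st v]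
  show "D v \<le> n" by (rule d(1))
  show "v \<in> C \<Longrightarrow> D v = n \<and> M v = 0" using d(2,3) by blast
  show "v \<notin> C \<Longrightarrow> M v = 0 \<longleftrightarrow> D v = 0" by (rule d(4))
  show "x \<in> G \<and> (x, v) \<in> A \<and> (\<forall>z. (x, z) \<in> A \<longrightarrow> D v \<le> Suc (D z))" if "M v = Suc x" for x
    using d(5-7)[OF that] by blast
  show "v = z" if "z < n" "M v = M z" "M v \<noteq> 0" for z by (rule d(8)[OF that])
next
  fix x assume "x \<in> G"
  then show "(\<exists>v<n. M v = Suc x) \<or> (\<forall>z. (x, z) \<in> A \<longrightarrow> n \<le> D z)"
    using auction_stateD'[OF st, of x] u by (cases "x = u") auto
qed

text \<open>The new price is one above the least price seen by the bidder, so its slack is 1. For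
  all other pairs the price of \<open>b\<close> occurs only as an upper bound, and raising it does
  no harm. The evicted partner leaves the settled set; if there is none, the removed set is empty
  and the matching grows.\<close>

lemma auction_bid:
  assumes A: "arcs_ok n A" and st: "auction_state n A C (G - {u}) D M"
    and u: "u \<in> G" "(u, b) \<in> A" "D b < n" and min: "\<And>z. (u, z) \<in> A \<Longrightarrow> D b \<le> D z"
  shows "auction_state n A C (G - {x. Suc x = M b}) (D(b := Suc (D b))) (M(b := Suc u))"
    and "M b \<noteq> 0 \<Longrightarrow> M b - 1 \<in> G"
    and "card (matched n (M(b := Suc u))) = card (matched n M) + (if M b = 0 then 1 else 0)"
proof -
  have b: "b < n" using A u(2) by (auto simp: arcs_ok_def)
  note db = auction_stateD[OF st b]
  have bC: "b \<notin> C" using db(2) u(3) by auto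
  have Mu: "M v \<noteq> Suc u" if "v < n" for v using auction_stateD(5)[OF st that, of u] by blast
  have mono: "D z \<le> (D(b := Suc (D b))) z" for z by simp
  show "auction_state n A C (G - {x. Suc x = M b}) (D(b := Suc (D b))) (M(b := Suc u))"
  proof (rule auction_stateI)
    fix v assume v: "v < n"
    note d = auction_stateD[OF st v]
    show "(D(b := Suc (D b))) v \<le> n" using d(1) u(3) by auto
    show "v \<in> C \<Longrightarrow> (D(b := Suc (D b))) v = n \<and> (M(b := Suc u)) v = 0" using d(2,3) bC by auto
    show "v \<notin> C \<Longrightarrow> (M(b := Suc u)) v = 0 \<longleftrightarrow> (D(b := Suc (D b))) v = 0" using d(4) by simp
    show "x \<in> G - {x. Suc x = M b} \<and> (x, v) \<in> A \<and>
        (\<forall>z. (x, z) \<in> A \<longrightarrow> (D(b := Suc (D b))) v \<le> Suc ((D(b := Suc (D b))) z))"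
      if x: "(M(b := Suc u)) v = Suc x" for x
    proof (cases "v = b")
      case True
      then have "x = u" using x by simp
      moreover have "Suc u \<noteq> M b" using Mu[OF b] by simp
      moreover have "D b \<le> (D(b := Suc (D b))) z" if "(u, z) \<in> A" for z
        using min[OF that] mono[of z] by (rule le_trans)
      ultimately show ?thesis using True u by simp
    next
      case False
      then have Mv: "M v = Suc x" using x by simp
      have "Suc x \<noteq> M b" using d(8)[OF b] Mv False by auto
      moreover have "D v \<le> Suc ((D(b := Suc (D b))) z)" if "(x, z) \<in> A" for z
        using d(7)[OF Mv that] mono[of z] by linarith
      ultimately show ?thesis using d(5,6)[OF Mv] False by auto
    qed
    show "v = z" if z: "z < n" "(M(b := Suc u)) v = (M(b := Suc u)) z" "(M(b := Suc u)) v \<noteq> 0" for z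
      using z d(8)[OF z(1)] Mu[OF v] Mu[OF z(1)] by (auto split: if_splits)
  next
    fix x assume x: "x \<in> G - {x. Suc x = M b}"
    show "(\<exists>v<n. (M(b := Suc u)) v = Suc x) \<or> (\<forall>z. (x, z) \<in> A \<longrightarrow> n \<le> (D(b := Suc (D b))) z)"
    proof (cases "x = u")
      case True
      then show ?thesis using b by (intro disjI1 exI[of _ b]) simp
    next
      case False
      then have "x \<in> G - {u}" using x by blast
      from auction_stateD'[OF st this] show ?thesis
      proof
        assume "\<exists>v<n. M v = Suc x"
        then obtain v where v: "v < n" "M v = Suc x" by blast
        then have "v \<noteq> b" using x by auto
        then show ?thesis using v by (intro disjI1 exI[of _ v]) simp
      next
        assume "\<forall>z. (x, z) \<in> A \<longrightarrow> n \<le> D z"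
        then show ?thesis using mono le_trans by blast
      qed
    qed
  qed
  show "M b - 1 \<in> G" if nz: "M b \<noteq> 0"
  proof -
    obtain x where x: "M b = Suc x" using nz not0_implies_Suc by blast
    then show ?thesis using db(5)[OF x] by simp
  qed
  have "matched n (M(b := Suc u)) = insert b (matched n M)" using b by (auto simp: matched_def)
  moreover have "finite (matched n M)" by (simp add: matched_def)
  moreover have "b \<in> matched n M \<longleftrightarrow> M b \<noteq> 0" using b by (simp add: matched_def)
  ultimately show "card (matched n (M(b := Suc u))) = card (matched n M) + (if M b = 0 then 1 else 0)"
    by (simp add: card_insert_if)
qed

text \<open>At most \<open>n\<close> units can be added to each of \<open>n\<close> prices, which
  limits the auction to \<open>n * n\<close> bids.\<close>

lemma auction_potential:
  fixes D :: "nat \<Rightarrow> nat"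
  assumes "b < n" "D b < n"
  shows "(\<Sum>v<n. n - (D(b := Suc (D b))) v) < (\<Sum>v<n. n - D v)"
  by (rule sum_strict_mono_ex1) (use assms in auto)

text \<open>A vertex on either side of a double cover accounts for at most \<open>B\<close> arcs.
  For \<open>2 m\<close> arcs this gives \<open>2 m / B \<le> lam\<close>, the link between the
  bound in the problem and the relaxation.\<close>

lemma card_arcs_le:
  assumes A: "arcs_ok n A" and deg: "\<And>u. u < n \<Longrightarrow> card {w. (u, w) \<in> A} \<le> B"
  shows "card A \<le> B * lam n A {}"
proof -
  obtain X Y where XY: "dcover n A {} X Y" "lam n A {} = card X + card Y"
    using lam_attained[OF A] by blast
  note d = dcoverD[OF XY(1)]
  have fin: "finite {w. (u, w) \<in> A}" for u
    by (rule finite_subset[of _ "{..<n}"]) (use A in \<open>auto simp: arcs_ok_def\<close>)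
  let ?O = "\<lambda>u. Pair u ` {w. (u, w) \<in> A}"
  let ?I = "\<lambda>w. (\<lambda>u. (u, w)) ` {u. (w, u) \<in> A}"
  have O: "card (\<Union> (?O ` X)) \<le> card X * B"
  proof -
    have "card (\<Union> (?O ` X)) \<le> (\<Sum>u\<in>X. card (?O u))" using d(1) by (rule card_UN_le)
    also have "\<dots> \<le> (\<Sum>u\<in>X. B)"
    proof (rule sum_mono)
      fix u assume "u \<in> X"
      then have "u < n" using d(5) by auto
      then show "card (?O u) \<le> B" using deg[of u] card_image_le[OF fin, of "Pair u" u] by linarith
    qed
    finally show ?thesis by simp
  qed
  have I: "card (\<Union> (?I ` Y)) \<le> card Y * B"
  proof -
    have "card (\<Union> (?I ` Y)) \<le> (\<Sum>u\<in>Y. card (?I u))" using d(2) by (rule card_UN_le)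
    also have "\<dots> \<le> (\<Sum>u\<in>Y. B)"
    proof (rule sum_mono)
      fix u assume "u \<in> Y"
      then have "u < n" using d(6) by auto
      then show "card (?I u) \<le> B" using deg[of u] card_image_le[OF fin, of "\<lambda>w. (w, u)" u] by linarith
    qed
    finally show ?thesis by simp
  qed
  have "A \<subseteq> \<Union> (?O ` X) \<union> \<Union> (?I ` Y)"
  proof
    fix e assume e: "e \<in> A"
    obtain u w where uw: "e = (u, w)" by force
    have "(w, u) \<in> A" using e A by (auto simp: uw arcs_ok_def dest: symD)
    moreover have "u \<in> X \<or> w \<in> Y" using d(7)[of u w] e uw by simp
    ultimately show "e \<in> \<Union> (?O ` X) \<union> \<Union> (?I ` Y)" using e unfolding uw by blast
  qed
  then have "card A \<le> card (\<Union> (?O ` X) \<union> \<Union> (?I ` Y))"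
    by (rule card_mono[rotated]) (use d fin in auto)
  also have "\<dots> \<le> card (\<Union> (?O ` X)) + card (\<Union> (?I ` Y))" by (rule card_Un_le)
  also have "\<dots> \<le> B * lam n A {}" using O I XY(2) by (simp add: algebra_simps)
  finally show ?thesis .
qed

section \<open>The program\<close>

text \<open>Variables: 2 \<open>Z = n + 64 m\<close>; 3 \<open>m\<close>; 4 \<open>n\<close>; 5 number of arcs; 6 number \<open>4 ^ k\<close> of guesses;
  7 budget \<open>m + k B\<close>; 8 guess; 10 unread part of the guess; 11 \<open>B\<close> times the size of the cover;
  12 answer; 13 arc under consideration, 15 and 16 its ends; 17 value of the relaxation; 19 size of
  the matching; 23 bidder plus 1, or 0; 24 and 25 least price and where it is attained; 31 \<open>B\<close>;
  32 \<open>k\<close>.  Arrays: 2 and 3 tails and heads of the arcs; 4 indicator of the cover; 5 prices;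
  6 partners.\<close>

definition scan :: com where
  "scan = AddK 24 4 0 ;; For 26 27 5 (
     Get 22 2 26 ;; AddK 22 22 1 ;; Minus 28 22 23 ;; Minus 29 23 22 ;; Plus 28 28 29 ;;
     Cond 28 Skip (
       Get 33 3 26 ;; Get 22 5 33 ;; Minus 28 24 22 ;;
       Cond 28 (AddK 24 22 0 ;; AddK 25 33 0) Skip))"

text \<open>Partners and the current bidder share the offset 1, so the evicted partner is copied to
  variable 23 and bids next; the value 0 ends the loop in both remaining cases.\<close>

definition bid :: com where
  "bid = scan ;; Minus 28 4 24 ;;
     Cond 28
       (AddK 24 24 1 ;; Put 5 25 24 ;; Get 22 6 25 ;; Put 6 25 23 ;; AddK 23 22 0 ;;
        Cond 22 Skip (AddK 19 19 1))
       (SetC 23 0)"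

definition relax :: com where
  "relax =
     For 20 21 4 (
       Get 22 4 20 ;; SetC 30 0 ;; Cond 22 (Put 5 20 4) (Put 5 20 30) ;; Put 6 20 30) ;;
     SetC 19 0 ;;
     For 20 21 4 (
       Get 22 4 20 ;; Cond 22 Skip (AddK 23 20 1 ;; Loop 23 bid))"

definition scanned :: "nat \<Rightarrow> (nat \<Rightarrow> nat) \<Rightarrow> (nat \<Rightarrow> nat \<Rightarrow> nat) \<Rightarrow> bool" where
  "scanned j v a \<longleftrightarrow> v 24 \<le> v 4 \<and> (\<forall>e<j. Suc (a 2 e) = v 23 \<longrightarrow> v 24 \<le> a 5 (a 3 e)) \<and>
     (v 24 < v 4 \<longrightarrow> (\<exists>e<j. Suc (a 2 e) = v 23 \<and> a 3 e = v 25 \<and> a 5 (v 25) = v 24))"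

lemma mod_scan [simp]: "mod_vars scan = {22, 24, 25, 26, 27, 28, 29, 33}" "mod_arrays scan = {}"
  by (auto simp: scan_def)

lemma mod_bid [simp]: "mod_vars bid = {19, 22, 23, 24, 25, 26, 27, 28, 29, 33}" "mod_arrays bid = {5, 6}"
  by (auto simp: bid_def)

lemma mod_relax [simp]:
  "mod_vars relax = {19, 20, 21, 22, 23, 24, 25, 26, 27, 28, 29, 30, 33}" "mod_arrays relax = {5, 6}"
  by (auto simp: relax_def)

lemma wp_scan:
  assumes Q: "\<And>v' a' t'. scanned (v 5) v' a \<Longrightarrow> agree scan v a v' a' \<Longrightarrow>
      t' \<le> t + 24 + v 5 * 97 \<Longrightarrow> Q v' a' t'"
  shows "wp w scan Q v a t"
  unfolding scan_def wp_Seq wp_simps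
proof (rule wp_For[where I = scanned and K = 80], goal_cases)
  case (8 j v' a' t')
  then show ?case by (auto simp: scanned_def less_Suc_eq)
next
  case (10 v' a' t')
  then show ?case by (intro Q) (auto simp: agree_def scanned_def)
qed (auto simp: scanned_def)


definition graph :: "nat \<Rightarrow> (nat \<times> nat) set \<Rightarrow> (nat \<Rightarrow> nat) \<Rightarrow> (nat \<Rightarrow> nat \<Rightarrow> nat) \<Rightarrow> bool" where
  "graph n A v a \<longleftrightarrow> arcs_ok n A \<and> v 4 = n \<and> A = (\<lambda>e. (a 2 e, a 3 e)) ` {..<v 5}"

text \<open>\<open>G\<close> collects the left vertices released so far. The subtracted set is the
  pending bidder, or empty if variable 23 is 0, so one formula serves during and after the
  bidding.\<close>

definition bidding :: "nat \<Rightarrow> (nat \<times> nat) set \<Rightarrow> nat set \<Rightarrow> nat set \<Rightarrow> (nat \<Rightarrow> nat) \<Rightarrow> (nat \<Rightarrow> nat \<Rightarrow> nat) \<Rightarrow> bool" where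
  "bidding n A C G v a \<longleftrightarrow> auction_state n A C (G - {x. Suc x = v 23}) (a 5) (a 6) \<and>
     (v 23 \<noteq> 0 \<longrightarrow> v 23 - 1 \<in> G) \<and> v 19 = card (matched n (a 6))"

text \<open>The \<open>Suc\<close> pays for the last round, in which the bidder gives up or takes a
  free vertex.\<close>

definition potential :: "nat \<Rightarrow> (nat \<Rightarrow> nat) \<Rightarrow> (nat \<Rightarrow> nat \<Rightarrow> nat) \<Rightarrow> nat" where
  "potential n v a = (if v 23 = 0 then 0 else Suc (\<Sum>z<n. n - a 5 z))"

lemma potential_le: "potential n v a \<le> n * n + 1"
proof -
  have "(\<Sum>z<n. n - a 5 z) \<le> (\<Sum>z<n. n)" by (rule sum_mono) simp
  then show ?thesis by (simp add: potential_def)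
qed

lemma wp_bid:
  assumes g: "graph n A v a" and b: "bidding n A C G v a" and cur: "v 23 \<noteq> 0"
    and Q: "\<And>v' a' t'. bidding n A C G v' a' \<Longrightarrow> potential n v' a' < potential n v a \<Longrightarrow>
      t' \<le> t + 97 * v 5 + 100 \<Longrightarrow> Q v' a' t'"
  shows "wp w bid Q v a t"
proof -
  obtain u where u: "v 23 = Suc u" using cur not0_implies_Suc by blast
  have G: "G - {x. Suc x = v 23} = G - {u}" using u by auto
  have st: "auction_state n A C (G - {u}) (a 5) (a 6)" and uG: "u \<in> G"
    and cnt: "v 19 = card (matched n (a 6))"
    using b unfolding bidding_def G u by auto
  have A: "arcs_ok n A" and n: "v 4 = n" and Adef: "A = (\<lambda>e. (a 2 e, a 3 e)) ` {..<v 5}"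
    using g by (auto simp: graph_def)
  show ?thesis
    unfolding bid_def wp_Seq
  proof (rule wp_scan)
    fix v' a' t'
    assume sc: "scanned (v 5) v' a" and ag: "agree scan v a v' a'" and t: "t' \<le> t + 24 + v 5 * 97"
    have v': "v' 4 = n" "v' 23 = Suc u" "v' 19 = v 19" and a': "a' = a"
      using ag n u by (auto simp: agree_def)
    have best: "v' 24 \<le> a 5 z" if "(u, z) \<in> A" for z
      using that sc v' unfolding scanned_def Adef by auto
    show "wp w (Minus 28 4 24) (wp w (Cond 28
       (AddK 24 24 1 ;; Put 5 25 24 ;; Get 22 6 25 ;; Put 6 25 23 ;; AddK 23 22 0 ;;
        Cond 22 Skip (AddK 19 19 1)) (SetC 23 0)) Q) v' a' t'"
    proof (cases "v' 24 < n")
      case True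
      define z where "z = v' 25"
      have z: "(u, z) \<in> A" "a 5 z = v' 24"
        using sc True v' unfolding scanned_def Adef z_def by (auto simp: image_iff)
      have lt: "a 5 z < n" using z True by simp
      have zn: "z < n" using z A by (auto simp: arcs_ok_def)
      note bid = auction_bid[OF A st uG z(1) lt, unfolded z(2), OF best]
      let ?a = "a(5 := (a 5)(z := Suc (v' 24)), 6 := (a 6)(z := Suc u))"
      have "Q v'' ?a t''" if "v'' 23 = a 6 z" "v'' 19 = v 19 + (if a 6 z = 0 then 1 else 0)"
        "t'' \<le> t' + 70" for v'' t''
      proof (rule Q)
        show "bidding n A C G v'' ?a"
          unfolding bidding_def using bid that cnt by simp
        show "potential n v'' ?a < potential n v a"
          using auction_potential[where D = "a 5", OF zn lt] z(2) that(1) u by (simp add: potential_def)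
        show "t'' \<le> t + 97 * v 5 + 100" using that(3) t by simp
      qed
      then show ?thesis
        using True v' a' by (simp add: z_def)
    next
      case False
      have "Q v'' a t''" if "v'' 23 = 0" "v'' 19 = v 19" "t'' \<le> t' + 70" for v'' t''
      proof (rule Q)
        have "auction_state n A C G (a 5) (a 6)"
          by (rule auction_discard[OF st _ uG]) (use best False in fastforce)
        then show "bidding n A C G v'' a"
          unfolding bidding_def using that cnt by simp
        show "potential n v'' a < potential n v a"
          using that(1) u by (simp add: potential_def)
        show "t'' \<le> t + 97 * v 5 + 100" using that(3) t by simp
      qed
      then show ?thesis
        using False v' a' by simp
    qed
  qed
qed

lemma wp_bids:
  assumes g: "graph n A v a" and b: "bidding n A C G v a"
    and Q: "\<And>v' a' t'. bidding n A C G v' a' \<Longrightarrow> v' 23 = 0 \<Longrightarrow>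
      t' \<le> t + (97 * v 5 + 103) * (n * n + 1) + 3 \<Longrightarrow> Q v' a' t'"
  shows "wp w (Loop 23 bid) Q v a t"
proof (rule wp_Loop[where I = "\<lambda>v' a' t'. bidding n A C G v' a' \<and>
      t' + (97 * v 5 + 103) * potential n v' a' \<le> t + (97 * v 5 + 103) * (n * n + 1)"
    and \<mu> = "potential n"])
  show "bidding n A C G v a \<and> t + (97 * v 5 + 103) * potential n v a \<le> t + (97 * v 5 + 103) * (n * n + 1)"
    using b potential_le[of n v a] by (simp only: add_le_cancel_left mult_le_mono2 simp_thms)
next
  fix v' a' t'
  let ?K = "97 * v 5 + 103"
  assume I: "bidding n A C G v' a' \<and> t' + ?K * potential n v' a' \<le> t + ?K * (n * n + 1)"
    and ag: "agree bid v a v' a'" and nz: "v' 23 \<noteq> 0"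
  have "graph n A v' a'" using g ag by (auto simp: graph_def agree_def)
  then show "wp w bid (\<lambda>v'' a'' t''. (bidding n A C G v'' a'' \<and>
        t'' + ?K * potential n v'' a'' \<le> t + ?K * (n * n + 1)) \<and>
        potential n v'' a'' < potential n v' a') v' a' (t' + 3)"
  proof (rule wp_bid[OF _ conjunct1[OF I] nz], intro conjI)
    fix v'' a'' t''
    assume *: "bidding n A C G v'' a''" "potential n v'' a'' < potential n v' a'"
      "t'' \<le> t' + 3 + 97 * v' 5 + 100"
    have "?K * Suc (potential n v'' a'') \<le> ?K * potential n v' a'"
      using *(2) by (intro mult_le_mono2) simp
    moreover have "v' 5 = v 5" using ag by (simp add: agree_def)
    ultimately show "t'' + ?K * potential n v'' a'' \<le> t + ?K * (n * n + 1)" using *(3) I by simp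
  qed auto
next
  fix v' a' t'
  assume "bidding n A C G v' a' \<and> t' + (97 * v 5 + 103) * potential n v' a' \<le> t + (97 * v 5 + 103) * (n * n + 1)"
    and "v' 23 = 0"
  then show "Q v' a' (t' + 3)" by (intro Q) auto
qed

text \<open>Each of the \<open>n\<close> left vertices is charged a full potential of
  \<open>n * n + 1\<close> rounds, and a round scans all arcs. Here \<open>m\<close> is the number
  of arcs, twice the number of edges.\<close>

definition relax_time :: "nat \<Rightarrow> nat \<Rightarrow> nat" where
  "relax_time n m = 100 + n * ((97 * m + 103) * (n * n + 1) + 200)"

definition inset :: "nat \<Rightarrow> (nat \<Rightarrow> nat \<Rightarrow> nat) \<Rightarrow> nat set" where
  "inset n a = {z. z < n \<and> a 4 z \<noteq> 0}"

lemma wp_relax: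
  assumes g: "graph n A v a"
    and Q: "\<And>v' a' t'. v' 19 = lam n A (inset n a) \<Longrightarrow> agree relax v a v' a' \<Longrightarrow>
      t' \<le> t + relax_time n (v 5) \<Longrightarrow> Q v' a' t'"
  shows "wp w relax Q v a t"
proof -
  let ?C = "inset n a"
  have A: "arcs_ok n A" and n: "v 4 = n" using g by (auto simp: graph_def)
  have "wp w relax (\<lambda>v' a' t'. v' 19 = lam n A ?C \<and> t' \<le> t + relax_time n (v 5)) v a t"
    unfolding relax_def wp_Seq
  proof (rule wp_For[where K = 40 and I = "\<lambda>j v' a'. \<forall>z<j. a' 5 z = (if a 4 z \<noteq> 0 then n else 0) \<and> a' 6 z = 0"],
      goal_cases)
    case (8 j v' a' t')
    then show ?case using n by (auto simp: agree_def less_Suc_eq)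
  next
    case (10 v1 a1 t1)
    have DM: "\<forall>z<n. a1 5 z = (if a 4 z \<noteq> 0 then n else 0) \<and> a1 6 z = 0" using 10(1) n by simp
    have v1: "v1 4 = n" "v1 5 = v 5" "a1 4 = a 4" "a1 2 = a 2" "a1 3 = a 3"
      using 10(2) n by (auto simp: agree_def)
    have "auction_state n A ?C ({..<0} - ?C) (a1 5) (a1 6)"
      by (rule auction_stateI) (use DM in \<open>auto simp: inset_def\<close>)
    moreover have "matched n (a1 6) = {}" using DM by (auto simp: matched_def)
    ultimately have init: "auction_state n A ?C ({..<0} - ?C) (a1 5) (a1 6) \<and> 0 = card (matched n (a1 6))"
      by simp
    show ?case
      unfolding wp_simps
    proof (rule wp_For[where K = "(97 * v 5 + 103) * (n * n + 1) + 30" and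
          I = "\<lambda>j v' a'. auction_state n A ?C ({..<j} - ?C) (a' 5) (a' 6) \<and> v' 19 = card (matched n (a' 6))"],
        goal_cases)
      case (8 j v2 a2 t2)
      have v2: "v2 4 = n" "v2 5 = v 5" "a2 4 = a 4" "a2 2 = a 2" "a2 3 = a 3"
        using 8(3) v1 by (auto simp: agree_def)
      have jn: "j < n" using 8(1) v1 by simp
      show ?case
      proof (cases "a 4 j = 0")
        case False
        then have "{..<Suc j} - ?C = {..<j} - ?C" using jn by (auto simp: inset_def less_Suc_eq)
        then show ?thesis using 8 False v2 by simp
      next
        case True
        then have jC: "j \<notin> ?C" by (simp add: inset_def)
        let ?G = "{..<Suc j} - ?C"
        let ?v = "v2(22 := 0, 23 := Suc j)"
        have "?G - {x. Suc x = ?v 23} = {..<j} - ?C" by auto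
        then have bd: "bidding n A ?C ?G ?v a2" using 8 jC by (simp add: bidding_def)
        have gr: "graph n A ?v a2" using g v2 by (auto simp: graph_def)
        have "wp w (Loop 23 bid) (\<lambda>v' a' t'. (auction_state n A ?C ({..<Suc j} - ?C) (a' 5) (a' 6) \<and>
           v' 19 = card (matched n (a' 6))) \<and> t' \<le> t2 + ((97 * v 5 + 103) * (n * n + 1) + 30)) ?v a2 (t2 + 17)"
          by (rule wp_bids[OF gr bd]) (use v2 in \<open>auto simp: bidding_def\<close>)
        then show ?thesis using 8(2) v2 True by (simp add: add.commute)
      qed
    next
      case (10 v3 a3 t3)
      have "v3 19 = lam n A ?C" using 10(1) v1 auction_lam[OF A, of ?C "a3 5" "a3 6"] by simp
      moreover have "t3 \<le> t + relax_time n (v 5)"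
        using 10(3) \<open>t1 \<le> _\<close> v1 n by (simp add: relax_time_def algebra_simps)
      ultimately show ?case by simp
    qed (use init in auto)
  qed auto
  from wp_agree[OF this] show ?thesis by (rule wp_conseq) (use Q in blast)
qed

section \<open>One branching step and one guess\<close>

text \<open>Variables 34 and 35 hold the constants 1 and 0. By truncation variable 18 becomes 0
  exactly if inserting the vertex lowers the relaxed optimum by at least 2.\<close>

definition probe :: "nat \<Rightarrow> com" where
  "probe x = Put 4 x 34 ;; relax ;; AddK 18 19 2 ;; Minus 18 18 17"

text \<open>The added 1 makes variable 18 nonzero exactly if twice the guess is at least the number
  of guesses, that is, if the leading bit is 1.\<close>

definition guess :: com where
  "guess = Plus 10 10 10 ;; AddK 18 10 1 ;; Minus 18 18 6 ;;
     Cond 18 (Minus 10 10 6 ;; Put 4 15 34) (Put 4 16 34)"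

text \<open>A probed vertex stays in the cover if its test succeeds and is withdrawn otherwise. Each
  path for an uncovered arc thus adds exactly one vertex, so a single addition of \<open>B\<close>
  keeps variable 11 up to date.\<close>

definition branch :: com where
  "branch = Get 15 2 13 ;; Get 16 3 13 ;; Get 18 4 15 ;; Get 28 4 16 ;; Plus 18 18 28 ;;
     Cond 18 Skip (
       relax ;; AddK 17 19 0 ;; SetC 34 1 ;; SetC 35 0 ;; probe 15 ;;
       Cond 18 (Put 4 15 35 ;; probe 16 ;; Cond 18 (Put 4 16 35 ;; guess) Skip) Skip ;;
       Plus 11 11 31)"

lemma mod_probe [simp]:
  "mod_vars (probe x) = {18, 19, 20, 21, 22, 23, 24, 25, 26, 27, 28, 29, 30, 33}" "mod_arrays (probe x) = {4, 5, 6}"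
  by (auto simp: probe_def)

lemma mod_branch [simp]:
  "mod_vars branch = {10, 11, 15, 16, 17, 18, 19, 20, 21, 22, 23, 24, 25, 26, 27, 28, 29, 30, 33, 34, 35}"
  "mod_arrays branch = {4, 5, 6}"
  by (auto simp: branch_def guess_def)

lemma inset_insert:
  assumes "a' 4 = (a 4)(z := Suc 0)" "z < n"
  shows "inset n a' = insert z (inset n a)"
  using assms by (auto simp: inset_def)

lemma wp_probe:
  assumes g: "graph n A v a" and "v 34 = 1" "v x < n"
    and Q: "\<And>v' a' t'. v' 18 = lam n A (insert (v x) (inset n a)) + 2 - v 17 \<Longrightarrow>
      a' 4 = (a 4)(v x := 1) \<Longrightarrow> agree (probe x) v a v' a' \<Longrightarrow> t' \<le> t + relax_time n (v 5) + 21 \<Longrightarrow> Q v' a' t'"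
  shows "wp w (probe x) Q v a t"
proof -
  let ?a = "a(4 := (a 4)(v x := 1))"
  have gr: "graph n A v ?a" using g by (auto simp: graph_def)
  have ins: "inset n ?a = insert (v x) (inset n a)" by (rule inset_insert) (use assms in auto)
  have "wp w relax (wp w (AddK 18 19 2 ;; Minus 18 18 17)
     (\<lambda>v' a' t'. v' 18 = lam n A (insert (v x) (inset n a)) + 2 - v 17 \<and> a' 4 = (a 4)(v x := 1) \<and>
        t' \<le> t + relax_time n (v 5) + 21)) v ?a (t + 7)"
  proof (rule wp_relax[OF gr])
    fix v' a' t'
    assume "v' 19 = lam n A (inset n ?a)" and ag: "agree relax v ?a v' a'"
      and "t' \<le> t + 7 + relax_time n (v 5)"
    then show "wp w (AddK 18 19 2 ;; Minus 18 18 17)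
     (\<lambda>v' a' t'. v' 18 = lam n A (insert (v x) (inset n a)) + 2 - v 17 \<and> a' 4 = (a 4)(v x := 1) \<and>
        t' \<le> t + relax_time n (v 5) + 21) v' a' t'"
      unfolding ins by (simp add: agree_def)
  qed
  then have "wp w (probe x) (\<lambda>v' a' t'. v' 18 = lam n A (insert (v x) (inset n a)) + 2 - v 17 \<and>
      a' 4 = (a 4)(v x := 1) \<and> t' \<le> t + relax_time n (v 5) + 21) v a t"
    using assms(2) by (simp add: probe_def)
  from wp_agree[OF this] show ?thesis by (rule wp_conseq) (use Q in blast)
qed

text \<open>One execution performs one unfolding of \<open>solve\<close>. The equation holds for
  every tail \<open>as\<close>, so the loop over the arcs can use it with the suffix not yet
  processed.\<close>

lemma wp_branch:
  assumes g: "graph n A v a" and e: "v 13 < v 5" and s: "v 11 = v 31 * card (inset n a)"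
    and uw: "u = a 2 (v 13)" "z = a 3 (v 13)"
  shows "wp w branch (\<lambda>v' a' t'.
      (\<forall>as. solve n A (v 6) as (inset n a') (v' 10) = solve n A (v 6) ((u, z) # as) (inset n a) (v 10)) \<and>
      v' 11 = v 31 * card (inset n a') \<and> t' \<le> t + (3 * relax_time n (v 5) + 200)) v a t"
    (is "wp w branch ?Q v a t")
proof -
  let ?C = "inset n a"
  let ?rt = "relax_time n (v 5)"
  have "(u, z) \<in> A" using g e uw by (auto simp: graph_def)
  then have un: "u < n" and zn: "z < n" using g by (auto simp: graph_def arcs_ok_def)
  have finC: "finite ?C" by (simp add: inset_def)
  define Post where "Post = ?Q"
  have "wp w branch Post v a t"
  proof (cases "u \<in> ?C \<or> z \<in> ?C")
    case True
    then have "a 4 u + a 4 z \<noteq> 0" by (auto simp: inset_def)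
    then show ?thesis using True s by (auto simp: branch_def uw Post_def)
  next
    case False
    then have free: "a 4 u = 0" "a 4 z = 0" using un zn by (auto simp: inset_def)
    have finish: "Post (v'(11 := v' 11 + v' 31)) a' (t' + 7)"
      if "y = u \<or> y = z" "a' 4 = (a 4)(y := Suc 0)" "v' 11 = v 11" "v' 31 = v 31"
        "t' \<le> t + 3 * ?rt + 193"
        "\<And>as. solve n A (v 6) ((u, z) # as) ?C (v 10) = solve n A (v 6) as (insert y ?C) (v' 10)"
      for y v' a' t'
    proof -
      have "y < n" "y \<notin> ?C" using that(1) un zn False by auto
      then have "inset n a' = insert y ?C" "card (insert y ?C) = Suc (card ?C)"
        using inset_insert[of a' a y n] that(2) finC by auto
      then show ?thesis using that s by (simp add: Post_def)
    qed
    define rest2 where "rest2 = Cond 18 (Put 4 16 35 ;; guess) Skip"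
    define rest1 where "rest1 = Cond 18 (Put 4 15 35 ;; probe 16 ;; rest2) Skip"
    let ?v0 = "v(15 := u, 16 := z, 28 := 0, 18 := 0)"
    have g0: "graph n A ?v0 a" using g by (auto simp: graph_def)
    have "wp w relax (wp w (AddK 17 19 0 ;; SetC 34 1 ;; SetC 35 0 ;; probe 15 ;; rest1 ;; Plus 11 11 31) Post)
      ?v0 a (t + 38)"
    proof (rule wp_relax[OF g0])
      fix v1 a1 t1
      assume r1: "v1 19 = lam n A ?C" "agree relax ?v0 a v1 a1" "t1 \<le> t + 38 + relax_time n (?v0 5)"
      have a1: "a1 4 = a 4" "a1 2 = a 2" "a1 3 = a 3" using r1(2) by (auto simp: agree_def)
      then have C1: "inset n a1 = ?C" by (simp add: inset_def)
      let ?v1 = "v1(17 := lam n A ?C, 34 := 1, 35 := 0)"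
      have v1: "?v1 15 = u" "?v1 16 = z" "?v1 5 = v 5" "?v1 6 = v 6" "?v1 10 = v 10" "?v1 11 = v 11" "?v1 31 = v 31" "?v1 4 = v 4"
        using r1(2) by (simp_all add: agree_def)
      have g1: "graph n A ?v1 a1" using g a1 v1 by (auto simp: graph_def)
      have "wp w (probe 15) (wp w (rest1 ;; Plus 11 11 31) Post) ?v1 a1 (t1 + 21)"
      proof (rule wp_probe[OF g1])
        fix v2 a2 t2
        assume r2: "v2 18 = lam n A (insert (?v1 15) (inset n a1)) + 2 - ?v1 17"
          "a2 4 = (a1 4)(?v1 15 := 1)" "agree (probe 15) ?v1 a1 v2 a2"
          "t2 \<le> t1 + 21 + relax_time n (?v1 5) + 21"
        have v2: "v2 15 = u" "v2 16 = z" "v2 5 = v 5" "v2 6 = v 6" "v2 10 = v 10" "v2 11 = v 11" "v2 31 = v 31"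
          "v2 4 = v 4" "v2 17 = lam n A ?C" "v2 34 = 1" "v2 35 = 0" "a2 2 = a 2" "a2 3 = a 3"
          using r2(3) v1 a1 by (simp_all add: agree_def)
        have 18: "v2 18 = lam n A (insert u ?C) + 2 - lam n A ?C" "a2 4 = (a 4)(u := Suc 0)"
          using r2(1,2) C1 v1 a1 by simp_all
        have t2: "t2 \<le> t + 2 * ?rt + 80" using r2(4) r1(3) v1 by simp
        show "wp w (rest1 ;; Plus 11 11 31) Post v2 a2 t2"
        proof (cases "lam n A (insert u ?C) + 2 \<le> lam n A ?C")
          case True
          have "Post (v2(11 := v2 11 + v2 31)) a2 (t2 + 3 + 7)"
            by (rule finish[of u]) (use False True v2 18 t2 in auto)
          then show ?thesis using True 18 by (simp add: rest1_def)
        next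
          case nu: False
          let ?a2 = "a2(4 := a 4)"
          have upd: "(a2 4)(u := 0) = a 4" using 18(2) free by auto
          have C2: "inset n ?a2 = ?C" by (simp add: inset_def)
          have g2: "graph n A v2 ?a2" using g v2 by (auto simp: graph_def)
          have "wp w (probe 16) (wp w (rest2 ;; Plus 11 11 31) Post) v2 ?a2 (t2 + 10)"
          proof (rule wp_probe[OF g2])
            fix v3 a3 t3
            assume r3: "v3 18 = lam n A (insert (v2 16) (inset n ?a2)) + 2 - v2 17"
              "a3 4 = (?a2 4)(v2 16 := 1)" "agree (probe 16) v2 ?a2 v3 a3"
              "t3 \<le> t2 + 10 + relax_time n (v2 5) + 21"
            have v3: "v3 15 = u" "v3 16 = z" "v3 6 = v 6" "v3 10 = v 10" "v3 11 = v 11" "v3 31 = v 31"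
              "v3 34 = 1" "v3 35 = 0"
              using r3(3) v2 by (simp_all add: agree_def)
            have 28: "v3 18 = lam n A (insert z ?C) + 2 - lam n A ?C" "a3 4 = (a 4)(z := Suc 0)"
              using r3(1,2) C2 v2 by simp_all
            have t3: "t3 \<le> t + 3 * ?rt + 111" using r3(4) t2 v2 by simp
            show "wp w (rest2 ;; Plus 11 11 31) Post v3 a3 t3"
            proof (cases "lam n A (insert z ?C) + 2 \<le> lam n A ?C")
              case True
              have "Post (v3(11 := v3 11 + v3 31)) a3 (t3 + 3 + 7)"
                by (rule finish[of z]) (use False nu True v3 28 t3 in auto)
              then show ?thesis using True 28 by (simp add: rest2_def)
            next
              case nz: False
              have upd: "(a3 4)(z := 0) = a 4" using 28(2) free by auto
              have sol: "solve n A (v 6) ((u, z) # as) ?C (v 10) =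
                  (if v 6 \<le> v 10 + v 10 then solve n A (v 6) as (insert u ?C) (v 10 + v 10 - v 6)
                   else solve n A (v 6) as (insert z ?C) (v 10 + v 10))" for as
                using False nu nz by (simp add: mult_2)
              show ?thesis
              proof (cases "v 6 \<le> v 10 + v 10")
                case True
                let ?v = "v3(10 := v 10 + v 10 - v 6, 18 := Suc (v 10 + v 10) - v 6)"
                let ?a = "a3(4 := (a 4)(u := Suc 0))"
                have "Post (?v(11 := ?v 11 + ?v 31)) ?a (t3 + 48 + 7)"
                  by (rule finish[of u]) (use True v3 t3 sol in auto)
                then show ?thesis
                  using nz 28 True v3 upd by (simp add: rest2_def guess_def fun_upd_twist add.commute)
              next
                case no: False
                let ?v = "v3(10 := v 10 + v 10, 18 := Suc (v 10 + v 10) - v 6)"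
                let ?a = "a3(4 := (a 4)(z := Suc 0))"
                have "Post (?v(11 := ?v 11 + ?v 31)) ?a (t3 + 41 + 7)"
                  by (rule finish[of z]) (use no v3 t3 sol in auto)
                then show ?thesis
                  using nz 28 no v3 upd by (simp add: rest2_def guess_def fun_upd_twist add.commute)
              qed
            qed
          qed (use v2 zn in auto)
          then show ?thesis using nu 18 v2 upd by (simp add: rest1_def add.commute)
        qed
      qed (use v1 un in auto)
      then show "wp w (AddK 17 19 0 ;; SetC 34 1 ;; SetC 35 0 ;; probe 15 ;; rest1 ;; Plus 11 11 31) Post v1 a1 t1"
        using r1(1) by (simp add: add.commute)
    qed
    then show ?thesis using free uw
      by (simp add: branch_def rest1_def rest2_def add.commute)
  qed
  then show ?thesis by (simp only: Post_def)
qed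

text \<open>Comparing \<open>B\<close> times the size of the cover with \<open>m + k B\<close>
  avoids division. The answer is only ever raised to 1, so successive trials compute a
  disjunction.\<close>

definition trial :: com where
  "trial = AddK 10 8 0 ;; SetC 11 0 ;; SetC 30 0 ;; For 20 21 4 (Put 4 20 30) ;;
     For 13 14 5 branch ;; Minus 18 11 7 ;; Cond 18 Skip (SetC 12 1)"

definition search :: com where
  "search = SetC 12 0 ;; For 8 9 6 trial"

lemma mod_trial [simp]:
  "mod_vars trial = {10, 11, 12, 13, 14, 15, 16, 17, 18, 19, 20, 21, 22, 23, 24, 25, 26, 27, 28, 29, 30, 33, 34, 35}"
  "mod_arrays trial = {4, 5, 6}"
  by (auto simp: trial_def)

lemma mod_search [simp]:
  "mod_vars search = insert 8 (insert 9 (mod_vars trial))" "mod_arrays search = {4, 5, 6}"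
  by (auto simp: search_def)

definition arc_list :: "(nat \<Rightarrow> nat) \<Rightarrow> (nat \<Rightarrow> nat \<Rightarrow> nat) \<Rightarrow> (nat \<times> nat) list" where
  "arc_list v a = map (\<lambda>e. (a 2 e, a 3 e)) [0..<v 5]"

definition trial_time :: "nat \<Rightarrow> nat \<Rightarrow> nat" where
  "trial_time n m = 100 + n * 24 + m * (217 + 3 * relax_time n m)"

lemma wp_trial:
  assumes g: "graph n A v a" and L: "L = arc_list v a" and x: "x = v 8"
  shows "wp w trial (\<lambda>v' a' t'.
      v' 12 = (if v 31 * card (solve n A (v 6) L {} x) \<le> v 7 then 1 else v 12) \<and>
      t' \<le> t + trial_time n (v 5)) v a t"
  unfolding trial_def wp_Seq wp_simps
proof (rule wp_For[where K = 7 and I = "\<lambda>j v' a'. v' 30 = 0 \<and> (\<forall>z<j. a' 4 z = 0)"], goal_cases)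
  case (10 v1 a1 t1)
  have v1: "v1 4 = n" "v1 5 = v 5" "v1 6 = v 6" "v1 7 = v 7" "v1 10 = x" "v1 11 = 0" "v1 12 = v 12" "v1 31 = v 31"
    "a1 2 = a 2" "a1 3 = a 3"
    using 10(2) g x by (auto simp: agree_def graph_def)
  have C1: "inset n a1 = {}" using 10(1) g by (auto simp: inset_def graph_def)
  have t1: "t1 \<le> t + 38 + n * 24" using 10(3) g by (simp add: graph_def)
  have lenL: "length L = v 5" by (simp add: L arc_list_def)
  show ?case
  proof (rule wp_For[where K = "3 * relax_time n (v 5) + 200" and I = "\<lambda>j v' a'.
        solve n A (v 6) (drop j L) (inset n a') (v' 10) = solve n A (v 6) L {} x \<and>
        v' 11 = v' 31 * card (inset n a')"], goal_cases)
    case (8 j v2 a2 t2)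
    have v2: "v2 4 = n" "v2 5 = v 5" "v2 6 = v 6" "v2 31 = v 31" "a2 2 = a 2" "a2 3 = a 3"
      using 8(3) v1 by (auto simp: agree_def)
    have j: "j < v 5" using 8(1) v1 by simp
    have g2: "graph n A v2 a2" using g v2 by (auto simp: graph_def)
    have e: "v2 13 < v2 5" "a2 2 (v2 13) = a 2 j" "a2 3 (v2 13) = a 3 j" using 8(2) j v2 by auto
    have dr: "drop j L = (a 2 j, a 3 j) # drop (Suc j) L"
      using Cons_nth_drop_Suc[of j L] j lenL by (simp add: L arc_list_def)
    from wp_agree[OF wp_branch[OF g2 e(1) conjunct2[OF 8(4)] e(2,3)[symmetric]]]
    show ?case
      by (rule wp_conseq) (use 8(4) v2 in \<open>auto simp: agree_def dr\<close>)
  next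
    case (10 v3 a3 t3)
    have v3: "v3 7 = v 7" "v3 12 = v 12" "v3 31 = v 31" using 10(2) v1 by (auto simp: agree_def)
    have "v3 11 = v 31 * card (solve n A (v 6) L {} x)" using 10(1) v1 v3 lenL by simp
    moreover have "t3 + 17 \<le> t + trial_time n (v 5)"
      using 10(3) t1 v1 by (simp add: trial_time_def)
    ultimately show ?case using v3 by auto
  qed (use v1 C1 in auto)
qed (auto simp: less_Suc_eq)

lemma wp_search:
  assumes g: "graph n A v a" and L: "L = arc_list v a"
  shows "wp w search (\<lambda>v' a' t'.
      v' 12 = (if \<exists>x<v 6. v 31 * card (solve n A (v 6) L {} x) \<le> v 7 then 1 else 0) \<and>
      t' \<le> t + 24 + v 6 * (trial_time n (v 5) + 17)) v a t"
  unfolding search_def wp_Seq wp_simps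
proof (rule wp_For[where K = "trial_time n (v 5)" and
      I = "\<lambda>j v' a'. v' 12 = (if \<exists>x<j. v 31 * card (solve n A (v 6) L {} x) \<le> v 7 then 1 else 0)"], goal_cases)
  case (8 j v1 a1 t1)
  have v1: "v1 4 = v 4" "v1 5 = v 5" "v1 6 = v 6" "v1 7 = v 7" "v1 31 = v 31" "a1 2 = a 2" "a1 3 = a 3"
    using 8(3) by (auto simp: agree_def)
  have g1: "graph n A v1 a1" using g v1 by (auto simp: graph_def)
  have L1: "L = arc_list v1 a1" using L v1 by (simp add: arc_list_def)
  show ?case
    by (rule wp_conseq[OF wp_trial[OF g1 L1 8(2)[symmetric]]]) (use 8(4) v1 in \<open>auto simp: less_Suc_eq\<close>)
qed auto

section \<open>Reading the input\<close>

text \<open>An input word below address 43 is read at distance \<open>Z - 3\<close>, held in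
  variable 36; all later words are still in place.\<close>

definition fetch :: "nat \<Rightarrow> com" where
  "fetch x = SetC 28 43 ;; Minus 29 28 22 ;; Cond 29 (Plus 28 22 36) (AddK 28 22 0) ;; Inp x 28"

lemma mod_fetch [simp]: "mod_vars (fetch x) = {28, 29, x}" "mod_arrays (fetch x) = {}"
  by (auto simp: fetch_def)

text \<open>The edge list follows a header of four words. Edge \<open>e\<close> yields the arcs
  \<open>e\<close> and \<open>e + m\<close>, one for each direction.\<close>

definition copy :: com where
  "copy = SetC 30 3 ;; Minus 36 2 30 ;;
     For 20 21 3 (
       Plus 22 20 20 ;; AddK 22 22 4 ;; fetch 15 ;; AddK 22 22 1 ;; fetch 16 ;;
       Put 2 20 15 ;; Put 3 20 16 ;; Plus 22 20 3 ;; Put 2 22 16 ;; Put 3 22 15)"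

lemma mod_copy [simp]:
  "mod_vars copy = {15, 16, 20, 21, 22, 28, 29, 30, 36}" "mod_arrays copy = {2, 3}"
  by (auto simp: copy_def)

text \<open>Five doublings of \<open>2 m\<close> give \<open>64 m\<close>, and subtracting this from
  \<open>Z\<close> recovers \<open>n\<close>. The answer is preset to 1, which is correct for
  \<open>B = 1\<close>; otherwise \<open>search\<close> replaces it.\<close>

definition main :: com where
  "main = AddK 31 0 0 ;; AddK 32 1 0 ;;
     Plus 18 3 3 ;; Plus 18 18 18 ;; Plus 18 18 18 ;; Plus 18 18 18 ;; Plus 18 18 18 ;; Plus 18 18 18 ;;
     Minus 4 2 18 ;; Plus 5 3 3 ;; copy ;;
     SetC 6 1 ;; AddK 7 3 0 ;; For 20 21 32 (Plus 6 6 6 ;; Plus 6 6 6 ;; Plus 7 7 31) ;;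
     SetC 12 1 ;; SetC 30 1 ;; Minus 18 31 30 ;; Cond 18 search Skip ;; AddK 0 12 0"

lemma wf_main: "wf_com main"
  by (simp add: main_def copy_def fetch_def search_def trial_def branch_def guess_def probe_def
      relax_def bid_def scan_def)

text \<open>The registers overlay the first 43 input words; word \<open>i + 3\<close>, for \<open>i < 40\<close>, has been moved to
  address \<open>Z + i\<close>.\<close>

definition saved :: "nat \<Rightarrow> (nat \<Rightarrow> nat) \<Rightarrow> nat \<Rightarrow> nat option" where
  "saved Z f p = (if 43 \<le> p \<and> p < Z then Some (f p)
     else if Z \<le> p \<and> p < Z + 40 then Some (f (p - Z + 3)) else None)"

lemma wp_fetch:
  assumes "v 36 = Z - 3" "64 \<le> Z" "4 \<le> v 22" "v 22 < Z"
    and Q: "\<And>i j t'. t' \<le> t + 31 \<Longrightarrow> Q (v(28 := i, 29 := j, x := f (v 22))) a t'"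
  shows "wp (saved Z f) (fetch x) Q v a t"
proof (cases "v 22 < 43")
  case True
  have "saved Z f (v 22 + (Z - 3)) = Some (f (v 22))"
    using True assms by (auto simp: saved_def intro: arg_cong[where f = f])
  then show ?thesis
    using True assms(1) unfolding fetch_def
    by (simp add: fun_upd_twist) (rule wp_Inp, simp, simp add: Q)
next
  case False
  have "saved Z f (v 22) = Some (f (v 22))"
    using False assms by (auto simp: saved_def)
  then show ?thesis
    using False assms(1) unfolding fetch_def
    by (simp add: fun_upd_twist) (rule wp_Inp, simp, subst fun_upd_twist[of 29 28], simp, rule Q, simp)
qed

definition copied :: "nat \<Rightarrow> (nat \<Rightarrow> nat) \<Rightarrow> nat \<Rightarrow> (nat \<Rightarrow> nat \<Rightarrow> nat) \<Rightarrow> bool" where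
  "copied m f j a \<longleftrightarrow> (\<forall>e<j. a 2 e = f (4 + 2 * e) \<and> a 3 e = f (5 + 2 * e) \<and>
     a 2 (e + m) = f (5 + 2 * e) \<and> a 3 (e + m) = f (4 + 2 * e))"

lemma copied_Suc:
  assumes "copied m f j a" "j < m"
    and "a' 2 = (a 2)(j := f (4 + 2 * j), j + m := f (5 + 2 * j))"
    and "a' 3 = (a 3)(j := f (5 + 2 * j), j + m := f (4 + 2 * j))"
  shows "copied m f (Suc j) a'"
  unfolding copied_def
proof (intro allI impI)
  fix e assume "e < Suc j"
  then consider "e = j" | "e < j" by linarith
  then show "a' 2 e = f (4 + 2 * e) \<and> a' 3 e = f (5 + 2 * e) \<and>
      a' 2 (e + m) = f (5 + 2 * e) \<and> a' 3 (e + m) = f (4 + 2 * e)"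
    using assms unfolding copied_def by cases auto
qed

lemma wp_copy:
  assumes "v 2 = Z" "64 \<le> Z" "v 3 = m" "2 * m + 4 \<le> Z"
  shows "wp (saved Z f) copy (\<lambda>v' a' t'. copied m f m a' \<and> t' \<le> t + 31 + m * 150) v a t"
  unfolding copy_def wp_Seq wp_simps
proof (rule wp_For[where K = 133 and I = "\<lambda>j v' a'. v' 36 = Z - 3 \<and> copied m f j a'"], goal_cases)
  case (8 j v1 a1 t1)
  have v1: "v1 3 = m" "v1 36 = Z - 3" "v1 20 = j" using 8 assms by (auto simp: agree_def)
  have j: "j < m" using 8(1) assms by simp
  show ?case
    unfolding wp_Seq wp_simps
  proof (rule wp_fetch, goal_cases)
    case 5: (5 p q t2)
    have idx: "v1 20 + v1 20 + 4 = 4 + 2 * j" "4 + 2 * j + 1 = 5 + 2 * j" "j + v1 3 = j + m"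
      using v1 by simp_all
    show ?case
    proof (rule wp_fetch, goal_cases)
      case 6: (5 p' q' t3)
      have c: "copied m f j a1" using 8(4) by (rule conjunct2)
      show ?case
        unfolding wp_simps
      proof (intro conjI copied_Suc[OF c j], goal_cases)
        case 1
        show ?case using v1 by simp
      next
        case 2
        show ?case by (simp add: v1(3) idx add.commute[of _ 4])
      next
        case 3
        show ?case by (simp add: v1(3) idx add.commute[of _ 4])
      next
        case 4
        show ?case using 5 6 by simp
      qed
    qed (use v1 assms j in simp_all)
  qed (use v1 assms j in simp_all)
qed (use assms in \<open>auto simp: copied_def\<close>)


lemma wp_main:
  assumes v: "v 0 = B" "v 1 = k" "v 2 = n + 64 * m" "v 3 = m" and m: "0 < m" "m = length es"
    and f: "\<And>i. i < m \<Longrightarrow> f (4 + 2 * i) = fst (es ! i) \<and> f (5 + 2 * i) = snd (es ! i)"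
    and L: "L = es @ map prod.swap es" and A: "A = set L" "arcs_ok n A"
  shows "wp (saved (n + 64 * m) f) main (\<lambda>v' a' t'.
      v' 0 = (if B \<le> 1 \<or> (\<exists>x<4 ^ k. B * card (solve n A (4 ^ k) L {} x) \<le> m + k * B) then 1 else 0) \<and>
      t' \<le> t + 300 + m * 150 + k * 38 +
        (if B \<le> 1 then 0 else 4 ^ k * (trial_time n (2 * m) + 17))) v a t"
proof -
  let ?Z = "n + 64 * m"
  let ?w = "saved ?Z f"
  define Q where "Q = (\<lambda>v' (a' :: nat \<Rightarrow> nat \<Rightarrow> nat) t'.
      v' (0::nat) = (if B \<le> 1 \<or> (\<exists>x<4 ^ k. B * card (solve n A (4 ^ k) L {} x) \<le> m + k * B) then 1 else (0::nat)) \<and>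
      t' \<le> t + 300 + m * 150 + k * 38 +
        (if B \<le> 1 then 0 else 4 ^ k * (trial_time n (2 * m) + 17)))"
  define fin where "fin = SetC 12 1 ;; SetC 30 1 ;; Minus 18 31 30 ;; Cond 18 search Skip ;; AddK 0 12 0"
  define pows where "pows = SetC 6 1 ;; AddK 7 3 0 ;; For 20 21 32 (Plus 6 6 6 ;; Plus 6 6 6 ;; Plus 7 7 31)"
  let ?v0 = "v(31 := B, 32 := k, 18 := 64 * m, 4 := n, 5 := 2 * m)"
  have "wp ?w copy (wp ?w pows (wp ?w fin Q)) ?v0 a (t + 70)"
  proof (rule wp_conseq[OF wp_agree[OF wp_copy[where Z = ?Z and m = m]]], goal_cases)
    case (5 v1 a1 t1)
    then have cp: "copied m f m a1" and ag: "agree copy ?v0 a v1 a1" and t1: "t1 \<le> t + 101 + m * 150" by auto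
    have v1: "v1 31 = B" "v1 32 = k" "v1 4 = n" "v1 5 = 2 * m" "v1 3 = m"
      using ag v by (auto simp: agree_def)
    have L1: "L = arc_list v1 a1"
    proof (rule nth_equalityI)
      show "length L = length (arc_list v1 a1)" using L m v1 by (simp add: arc_list_def)
      fix i assume i: "i < length L"
      then have i2: "i < 2 * m" using L m by simp
      show "L ! i = arc_list v1 a1 ! i"
      proof (cases "i < m")
        case True
        then show ?thesis using cp f[of i] i2 m L v1 by (simp add: arc_list_def copied_def nth_append)
      next
        case False
        define e where "e = i - m"
        have e: "e < m" "i = e + m" using False i2 by (auto simp: e_def)
        have "L ! i = prod.swap (es ! e)" using L m e by (simp add: nth_append)
        moreover have "a1 2 i = snd (es ! e)" "a1 3 i = fst (es ! e)"
          using cp f[of e] e unfolding copied_def by auto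
        ultimately show ?thesis using i2 v1 by (simp add: arc_list_def prod.swap_def)
      qed
    qed
    have g1: "graph n A v1 a1"
      using A v1 L1 by (auto simp: graph_def arc_list_def)
    have "wp ?w pows (wp ?w fin Q) v1 a1 t1"
      unfolding pows_def wp_Seq wp_simps
    proof (rule wp_For[where K = 21 and I = "\<lambda>j v' a'. v' 6 = 4 ^ j \<and> v' 7 = m + j * B"], goal_cases)
      case (8 j v2 a2 t2)
      then show ?case using v1 by (auto simp: agree_def)
    next
      case (10 v3 a3 t3)
      have v3: "v3 31 = B" "v3 4 = n" "v3 5 = 2 * m" "v3 6 = 4 ^ k" "v3 7 = m + k * B" "a3 2 = a1 2" "a3 3 = a1 3"
        using 10(1,2) v1 by (auto simp: agree_def)
      have t3: "t3 \<le> t + 132 + m * 150 + k * 38" using 10(3) t1 v1 by simp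
      show ?case
      proof (cases "B \<le> 1")
        case True
        then show ?thesis using v3 t3 by (simp add: fin_def Q_def)
      next
        case False
        let ?v3 = "v3(12 := 1, 30 := 1, 18 := B - 1)"
        have g3: "graph n A ?v3 a3" using g1 v1 v3 by (auto simp: graph_def)
        have L3: "L = arc_list ?v3 a3" using L1 v1 v3 by (simp add: arc_list_def)
        have "wp ?w search (wp ?w (AddK 0 12 0) Q) ?v3 a3 (t3 + 24)"
          by (rule wp_conseq[OF wp_search[OF g3 L3]]) (use False v3 t3 in \<open>simp add: Q_def\<close>)
        then show ?thesis using False v3 by (simp add: fin_def add.commute)
      qed
    qed (use v1 in auto)
    then show ?case .
  qed (use v m(1) in auto)
  then have "wp ?w main Q v a t"
    using v by (simp add: main_def pows_def fin_def add.commute flip: mult_2)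
  then show ?thesis by (simp only: Q_def)
qed

section \<open>Freeing the registers\<close>

text \<open>Register 2 is the advancing write pointer and register 3 holds the constant 1.\<close>

definition save_code :: "nat list \<Rightarrow> instr list" where
  "save_code rs = concat (map (\<lambda>r. [Add 2 2 3, StoreI 2 r]) rs)"

lemma length_save_code [simp]: "length (save_code rs) = 2 * length rs"
  by (induction rs) (simp_all add: save_code_def)

lemma reach_add:
  assumes "code_at P p (replicate j (Add 2 2 3))"
  shows "reach P j (p, mem) (p + j, mem(2 := mem 2 + j * mem 3))"
  using assms
proof (induction j arbitrary: p mem)
  case 0
  then show ?case by (simp add: reach_refl)
next
  case (Suc j)
  let ?m = "mem(2 := mem 2 + mem 3)"
  have c: "p < length P \<and> P ! p = Add 2 2 3" "code_at P (Suc p) (replicate j (Add 2 2 3))"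
    using Suc.prems by (simp_all add: code_at_Cons)
  have "reach P j (Suc p, ?m) (Suc p + j, ?m(2 := ?m 2 + j * ?m 3))" using Suc.IH[OF c(2)] .
  then have "reach P (Suc j) (p, mem) (Suc p + j, ?m(2 := ?m 2 + j * ?m 3))"
    by (intro reach_exec[OF c(1)]) simp
  moreover have "?m(2 := ?m 2 + j * ?m 3) = mem(2 := mem 2 + Suc j * mem 3)" by (simp add: add.assoc)
  ultimately show ?case by (simp only: add_Suc add_Suc_right)
qed

lemma reach_save:
  assumes "code_at P p (save_code rs)" "mem 2 = z" "mem 3 = 1" "3 < z" "\<forall>r\<in>set rs. r < z \<and> r \<noteq> 2"
  shows "\<exists>mem'. reach P (2 * length rs) (p, mem) (p + 2 * length rs, mem') \<and>
    mem' 2 = z + length rs \<and> (\<forall>i<length rs. mem' (z + Suc i) = mem (rs ! i)) \<and>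
    (\<forall>q. q \<noteq> 2 \<longrightarrow> q \<le> z \<or> z + length rs < q \<longrightarrow> mem' q = mem q)"
  using assms
proof (induction rs arbitrary: p mem z)
  case Nil
  then show ?case using reach_refl by (intro exI[of _ mem]) auto
next
  case (Cons r rs)
  let ?m = "mem(2 := z + 1, z + 1 := mem r)"
  have c: "p < length P \<and> P ! p = Add 2 2 3" "Suc p < length P \<and> P ! Suc p = StoreI 2 r"
    "code_at P (p + 2) (save_code rs)"
    using Cons.prems(1) by (simp_all add: save_code_def code_at_Cons)
  have "reach P 1 (p, mem) (Suc p, mem(2 := z + 1))"
    using reach_one[OF c(1), of mem] Cons.prems by simp
  moreover have "reach P 1 (Suc p, mem(2 := z + 1)) (p + 2, ?m)"
    using reach_one[OF c(2), of "mem(2 := z + 1)"] Cons.prems by simp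
  ultimately have r: "reach P (1 + 1) (p, mem) (p + 2, ?m)" by (rule reach_trans)
  have "\<exists>mem'. reach P (2 * length rs) (p + 2, ?m) (p + 2 + 2 * length rs, mem') \<and>
    mem' 2 = z + 1 + length rs \<and> (\<forall>i<length rs. mem' (z + 1 + Suc i) = ?m (rs ! i)) \<and>
    (\<forall>q. q \<noteq> 2 \<longrightarrow> q \<le> z + 1 \<or> z + 1 + length rs < q \<longrightarrow> mem' q = ?m q)"
    by (rule Cons.IH[OF c(3)]) (use Cons.prems in auto)
  then obtain mem' where m: "reach P (2 * length rs) (p + 2, ?m) (p + 2 + 2 * length rs, mem')"
    "mem' 2 = z + 1 + length rs" "\<And>i. i < length rs \<Longrightarrow> mem' (z + 1 + Suc i) = ?m (rs ! i)"
    "\<And>q. q \<noteq> 2 \<Longrightarrow> q \<le> z + 1 \<or> z + 1 + length rs < q \<Longrightarrow> mem' q = ?m q"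
    by blast
  have "mem' (z + Suc i) = mem ((r # rs) ! i)" if i: "i < Suc (length rs)" for i
  proof (cases i)
    case 0
    then show ?thesis using m(4)[of "z + 1"] Cons.prems by simp
  next
    case (Suc i')
    then have "rs ! i' \<in> set rs" "i' < length rs" using i by auto
    moreover from this have "rs ! i' < z" "rs ! i' \<noteq> 2" using Cons.prems by auto
    ultimately show ?thesis using m(3)[of i'] Suc by simp
  qed
  moreover have "mem' q = mem q" if "q \<noteq> 2" "q \<le> z \<or> z + Suc (length rs) < q" for q
    using m(4)[of q] that by auto
  moreover have "reach P (2 * Suc (length rs)) (p, mem) (p + 2 * Suc (length rs), mem')"
    using reach_trans[OF r m(1)] by simp
  ultimately show ?case using m(2) by (intro exI[of _ mem']) auto
qed

text \<open>No register is free initially.  Adding \<open>64 m\<close> to the register that holds \<open>n\<close> yields an address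
  \<open>Z\<close> beyond both the input and the registers without losing information, since \<open>n = Z - 64 m\<close>.
  This needs \<open>m > 0\<close>.\<close>

definition prologue :: "instr list" where
  "prologue = replicate 64 (Add 2 2 3) @ [StoreI 2 3, LoadC 3 1] @ save_code [4..<43] @
     [Add 42 2 3, LoadC 4 39, Sub 2 2 4, LoadI 3 2]"

lemma length_prologue: "length prologue = 148"
  by (simp add: prologue_def)

text \<open>The code is straight-line, whence 148 steps. Word 3 goes to \<open>Z\<close> and words 4
  to 42 follow, so the arrays start at \<open>Z + 40\<close>. Subtracting 39 returns the pointer to
  \<open>Z\<close>, from which \<open>m\<close> is reloaded.\<close>

lemma reach_prologue:
  assumes P: "code_at P p prologue" and m: "mem 3 = m" "0 < m" and Z: "Z = mem 2 + 64 * m"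
  shows "\<exists>mem'. reach P 148 (p, mem) (p + 148, mem') \<and> mem' 0 = mem 0 \<and> mem' 1 = mem 1 \<and>
    mem' 2 = Z \<and> mem' 3 = m \<and> mem' 42 = Z + 40 \<and>
    (\<forall>q. 43 \<le> q \<longrightarrow> q < Z \<longrightarrow> mem' q = mem q) \<and> (\<forall>i<40. mem' (Z + i) = mem (i + 3))"
proof -
  have Z64: "64 \<le> Z" using Z m by simp
  have c: "code_at P p (replicate 64 (Add 2 2 3))" "code_at P (p + 64) [StoreI 2 3, LoadC 3 1]"
    "code_at P (p + 66) (save_code [4..<43])"
    "code_at P (p + 144) [Add 42 2 3, LoadC 4 39, Sub 2 2 4, LoadI 3 2]"
    using P unfolding prologue_def code_at_append
    by (simp_all add: add.commute)
  let ?m1 = "mem(2 := Z)"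
  have r1: "reach P 64 (p, mem) (p + 64, ?m1)"
    using reach_add[OF c(1), of mem] Z m by simp
  let ?m2 = "?m1(Z := m, 3 := 1)"
  have "reach P 1 (p + 64, ?m1) (Suc (p + 64), ?m1(Z := m))"
    using reach_one[of "p + 64" P "StoreI 2 3" ?m1] c(2) m by (simp add: code_at_Cons)
  moreover have "reach P 1 (Suc (p + 64), ?m1(Z := m)) (p + 66, ?m2)"
    using reach_one[of "Suc (p + 64)" P "LoadC 3 1" "?m1(Z := m)"] c(2)
    by (simp add: code_at_Cons add.commute)
  ultimately have r2: "reach P (1 + 1) (p + 64, ?m1) (p + 66, ?m2)" by (rule reach_trans)
  define rs where "rs = [4..<43::nat]"
  have rs: "length rs = 39" "\<And>i. i < 39 \<Longrightarrow> rs ! i = 4 + i" "\<forall>r\<in>set rs. r < Z \<and> r \<noteq> 2"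
    using Z64 by (simp_all del: upt_Suc upt_rec_numeral add: rs_def nth_upt)
  have "\<exists>mem'. reach P (2 * length rs) (p + 66, ?m2) (p + 66 + 2 * length rs, mem') \<and>
    mem' 2 = Z + length rs \<and> (\<forall>i<length rs. mem' (Z + Suc i) = ?m2 (rs ! i)) \<and>
    (\<forall>q. q \<noteq> 2 \<longrightarrow> q \<le> Z \<or> Z + length rs < q \<longrightarrow> mem' q = ?m2 q)"
    by (rule reach_save) (use c(3) rs(3) Z64 in \<open>auto simp: rs_def simp del: upt_Suc upt_rec_numeral\<close>)
  then obtain m3 where "reach P (2 * length rs) (p + 66, ?m2) (p + 66 + 2 * length rs, m3)"
    "m3 2 = Z + length rs" "\<And>i. i < length rs \<Longrightarrow> m3 (Z + Suc i) = ?m2 (rs ! i)"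
    "\<And>q. q \<noteq> 2 \<Longrightarrow> q \<le> Z \<Longrightarrow> m3 q = ?m2 q"
    by blast
  then have m3: "reach P 78 (p + 66, ?m2) (p + 144, m3)" "m3 2 = Z + 39"
    "\<And>i. i < 39 \<Longrightarrow> m3 (Z + Suc i) = ?m2 (4 + i)"
    "\<And>q. q \<noteq> 2 \<Longrightarrow> q \<le> Z \<Longrightarrow> m3 q = ?m2 q"
    unfolding rs(1) using rs(2) by (simp_all add: add.assoc)
  have m33: "m3 3 = 1" using m3(4)[of 3] Z64 by simp
  have m3Z: "m3 Z = m" using m3(4)[of Z] Z64 by simp
  let ?m4 = "m3(42 := Z + 40, 4 := 39, 2 := Z, 3 := m)"
  have "(step P ^^ Suc (Suc (Suc (Suc 0)))) (p + 144, m3) = (p + 148, ?m4)"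
    using c(4) m3(2) m33 m3Z Z64 unfolding code_at_Cons funpow_Suc_right
    by (simp add: step_def add.commute)
  then have r4: "reach P 4 (p + 144, m3) (p + 148, ?m4)"
    unfolding reach_def by (intro exI[of _ 4]) (simp add: eval_nat_numeral)
  have "reach P 148 (p, mem) (p + 148, ?m4)"
    using reach_trans[OF reach_trans[OF reach_trans[OF r1 r2] m3(1)] r4] by simp
  moreover have "?m4 0 = mem 0" "?m4 1 = mem 1" using m3(4)[of 0] m3(4)[of 1] Z64 by simp_all
  moreover have "?m4 q = mem q" if "43 \<le> q" "q < Z" for q using that m3(4)[of q] by simp
  moreover have "?m4 (Z + i) = mem (i + 3)" if i: "i < 40" for i
  proof (cases i)
    case 0
    then show ?thesis using Z64 m3Z m by simp
  next
    case (Suc i')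
    then show ?thesis using m3(3)[of i'] Z64 i by (simp add: add.commute)
  qed
  ultimately show ?thesis by (intro exI[of _ ?m4]) auto
qed

definition main_code :: "instr list" where
  "main_code = compile 149 main"

text \<open>If there are no edges, the opening test jumps to the last instruction, which answers 1.
  Otherwise the main code ends with a jump past it.\<close>

definition program :: "instr list" where
  "program = [Jz 3 (151 + length main_code)] @ prologue @ main_code @
     [LoadC 40 0, Jz 40 (152 + length main_code), LoadC 0 1]"

lemma length_program: "length program = 152 + length main_code"
  by (simp add: program_def length_prologue)

lemma runs_withinI:
  assumes "reach P T (init xs) (p, mem)" "length P \<le> p" "mem 0 = out"
  shows "runs_within P xs T out"
  using assms unfolding runs_within_def reach_def halted_def by fastforce

lemma program_zero:
  assumes "snd (init xs) 3 = 0"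
  shows "runs_within program xs 2 1"
proof (rule runs_withinI)
  let ?l = "151 + length main_code"
  have i: "init xs = (0, snd (init xs))" by (simp add: init_def)
  have c: "0 < length program \<and> program ! 0 = Jz 3 ?l" by (simp add: program_def)
  have "program = ([Jz 3 ?l] @ prologue @ main_code @ [LoadC 40 0, Jz 40 (152 + length main_code)]) @ [LoadC 0 1]"
    by (simp add: program_def)
  moreover have "length ([Jz 3 ?l] @ prologue @ main_code @ [LoadC 40 0, Jz 40 (152 + length main_code)]) = ?l"
    by (simp add: length_prologue)
  ultimately have "code_at program ?l [LoadC 0 1]"
    unfolding code_at_def by (metis append_Nil2)
  then have c2: "?l < length program \<and> program ! ?l = LoadC 0 1"
    by (simp add: code_at_Cons)
  have "reach program 1 (init xs) (?l, snd (init xs))"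
    using reach_one[OF c, of "snd (init xs)"] assms by (subst i) simp
  from reach_trans[OF this reach_one[OF c2]]
  show "reach program 2 (init xs) (Suc ?l, (snd (init xs))(0 := 1))" by (simp add: numeral_2_eq_2)
qed (simp_all add: length_program)

lemma program_main:
  assumes f: "f = snd (init xs)" and m: "f 3 = m" "0 < m" and n: "f 2 = n"
    and wp: "\<And>v a. v 0 = f 0 \<Longrightarrow> v 1 = f 1 \<Longrightarrow> v 2 = n + 64 * m \<Longrightarrow> v 3 = m \<Longrightarrow>
      wp (saved (n + 64 * m) f) main (\<lambda>v' a' t'. v' 0 = out \<and> t' \<le> T) v a 0"
  shows "runs_within program xs (T + 151) out"
proof -
  let ?Z = "n + 64 * m"
  let ?l = "151 + length main_code"
  have i: "init xs = (0, f)" by (simp add: f init_def)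
  have "code_at program 0 program" unfolding code_at_def by (metis append_Nil append_Nil2 list.size(3))
  then have "code_at program 0 ([Jz 3 ?l] @ prologue @ main_code @
      [LoadC 40 0, Jz 40 (152 + length main_code)] @ [LoadC 0 1])"
    by (simp add: program_def)
  then have c: "0 < length program \<and> program ! 0 = Jz 3 ?l" "code_at program 1 prologue"
    "code_at program 149 main_code"
    "code_at program (149 + length main_code) [LoadC 40 0, Jz 40 (152 + length main_code)]"
    unfolding code_at_append by (simp_all add: length_prologue code_at_Cons[of _ _ "Jz 3 _"])
  have r0: "reach program 1 (0, f) (1, f)"
    using reach_one[OF c(1), of f] m by simp
  obtain m1 where r1: "reach program 148 (1, f) (1 + 148, m1)" and m1: "m1 0 = f 0" "m1 1 = f 1"
    "m1 2 = ?Z" "m1 3 = m" "m1 42 = ?Z + 40" "\<And>q. 43 \<le> q \<Longrightarrow> q < ?Z \<Longrightarrow> m1 q = f q"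
    "\<And>i. i < 40 \<Longrightarrow> m1 (?Z + i) = f (i + 3)"
    using reach_prologue[OF c(2), of f m ?Z] m n by auto
  \<comment> \<open>The arrays start with whatever the memory beyond the base contains;
    \<open>wp\<close> is assumed for all initial contents.\<close>
  define a where "a j i = m1 (m1 42 + 8 * i + j)" for j i
  have rep: "rep (saved ?Z f) m1 a m1"
    unfolding rep_def
  proof (intro conjI allI impI)
    fix p c assume s: "saved ?Z f p = Some c"
    show "43 \<le> p" "p < m1 42" using s m m1(5) by (auto simp: saved_def split: if_splits)
    show "m1 p = c"
    proof (cases "p < ?Z")
      case True
      then show ?thesis using s m1(6)[of p] by (auto simp: saved_def split: if_splits)
    next
      case False
      then have "c = f (p - ?Z + 3)" "p < ?Z + 40" using s by (auto simp: saved_def split: if_splits)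
      then show ?thesis using m1(7)[of "p - ?Z"] False by simp
    qed
  qed (use m1(5) m(2) a_def in auto)
  obtain v' a' t' where run: "run (saved ?Z f) main (m1, a, 0) (v', a', t')" and out: "v' 0 = out" "t' \<le> T"
    using wp[OF m1(1-4), of a] unfolding wp_def by blast
  obtain T' m2 where r2: "reach program T' (149, m1) (149 + length main_code, m2)" "T' \<le> t'"
    and rep2: "rep (saved ?Z f) v' a' m2"
    using comp_correct[OF run wf_main, of program 149 m1] c(3) rep unfolding main_code_def by auto
  have "reach program (1 + 148 + T' + 2) (0, f) (152 + length main_code, m2(40 := 0))"
    using reach_trans[OF reach_trans[OF reach_trans[OF r0 r1] _] reach_jump[OF c(4)]] r2(1) by simp
  then have "reach program (T + 151) (init xs) (152 + length main_code, m2(40 := 0))"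
    unfolding i by (rule reach_mono) (use r2(2) out in simp)
  moreover have "(m2(40 := 0)) 0 = out" using rep_simps(1)[OF rep2, of 0] out by simp
  ultimately show ?thesis
    using runs_withinI[of program "T + 151" xs "152 + length main_code" "m2(40 := 0)" out]
    by (simp add: length_program)
qed

section \<open>Correctness and running time\<close>

lemma encode_input:
  assumes f: "f = snd (init (encode B k n es))"
  shows "f 0 = B" "f 1 = k" "f 2 = n" "f 3 = length es"
    and "i < length es \<Longrightarrow> f (4 + 2 * i) = fst (es ! i) \<and> f (5 + 2 * i) = snd (es ! i)"
proof -
  have len: "length (concat (map (\<lambda>(u, v). [u, v]) es)) = 2 * length es" for es :: "(nat \<times> nat) list"
    by (induction es) auto
  have nth: "i < length es \<Longrightarrow> concat (map (\<lambda>(u, v). [u, v]) es) ! (2 * i) = fst (es ! i) \<and>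
      concat (map (\<lambda>(u, v). [u, v]) es) ! Suc (2 * i) = snd (es ! i)" for i and es :: "(nat \<times> nat) list"
    by (induction es arbitrary: i) (auto simp: nth_Cons split: nat.splits)
  show "f 0 = B" "f 1 = k" "f 2 = n" "f 3 = length es"
    by (simp_all add: f init_def encode_def)
  assume i: "i < length es"
  have eq: "4 + 2 * i = Suc (Suc (Suc (Suc (2 * i))))" "5 + 2 * i = Suc (Suc (Suc (Suc (Suc (2 * i)))))" by simp_all
  show "f (4 + 2 * i) = fst (es ! i) \<and> f (5 + 2 * i) = snd (es ! i)"
    unfolding eq using nth[OF i] i len[of es] by (simp add: f init_def encode_def)
qed

section \<open>From edges to arcs\<close>

context
  fixes n B k :: nat and E :: "nat set set" and es L :: "(nat \<times> nat) list" and A :: "(nat \<times> nat) set"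
  assumes simple: "simple_graph n E" and edges: "edge_list_of es E" and deg: "max_degree_le n E B"
    and L: "L = es @ map prod.swap es" and A: "A = set L"
begin

lemma edge_props:
  assumes "(u, w) \<in> set es"
  shows "u < n" "w < n" "u \<noteq> w" "{u, w} \<in> E"
proof -
  show E: "{u, w} \<in> E" using assms edges by (auto simp: edge_list_of_def)
  then obtain x y where "{u, w} = {x, y}" "x \<noteq> y" "x < n" "y < n"
    using simple by (auto simp: simple_graph_def)
  then show "u < n" "w < n" "u \<noteq> w" by (auto simp: doubleton_eq_iff)
qed

lemma arc_iff: "(u, w) \<in> A \<longleftrightarrow> {u, w} \<in> E"
proof
  assume "(u, w) \<in> A"
  then have "(u, w) \<in> set es \<or> (w, u) \<in> set es" by (auto simp: A L)
  then show "{u, w} \<in> E" using edge_props(4)[of u w] edge_props(4)[of w u] insert_commute[of u w "{}"] by auto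
next
  assume "{u, w} \<in> E"
  then obtain x y where "(x, y) \<in> set es" "{u, w} = {x, y}"
    using edges by (force simp: edge_list_of_def)
  then show "(u, w) \<in> A" by (force simp: A L doubleton_eq_iff)
qed

lemma arcs_ok: "arcs_ok n A"
proof -
  have "sym A" unfolding sym_def arc_iff by (simp add: insert_commute)
  moreover have "A \<subseteq> {..<n} \<times> {..<n}" using edge_props by (auto simp: A L)
  ultimately show ?thesis by (simp add: arcs_ok_def)
qed

lemma card_edges: "card E = length es"
proof -
  have "card (set (map (\<lambda>(u, v). {u, v}) es)) = length (map (\<lambda>(u, v). {u, v}) es)"
    by (rule distinct_card) (use edges in \<open>simp add: edge_list_of_def\<close>)
  then show ?thesis using edges by (simp add: edge_list_of_def)
qed

lemma card_arcs: "card A = 2 * length es"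
proof -
  have inj: "inj_on (\<lambda>(u, w). {u, w}) (set es)" and d: "distinct es"
    using edges by (auto simp: edge_list_of_def distinct_map)
  \<comment> \<open>Both orientations denote the same edge, so by distinctness of the edge list they
    would be one pair, hence a loop.\<close>
  have "False" if "(u, w) \<in> set es" "(w, u) \<in> set es" for u w
  proof -
    have "(u, w) = (w, u)"
      by (rule inj_onD[OF inj]) (use that in auto)
    then show False using edge_props(3)[OF that(1)] by simp
  qed
  then have "set es \<inter> prod.swap ` set es = {}" by auto
  then have "distinct L" using d by (simp add: L distinct_map)
  then have "card A = length L" unfolding A by (rule distinct_card)
  then show ?thesis by (simp add: L)
qed

text \<open>The final time bound mentions \<open>n\<close> but not the number of edges.\<close>

lemma card_edges_le: "2 * length es \<le> n * n"
proof -
  have "card A \<le> card ({..<n} \<times> {..<n})"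
    by (rule card_mono) (use arcs_ok in \<open>auto simp: arcs_ok_def\<close>)
  then show ?thesis by (simp add: card_arcs)
qed

lemma out_degree:
  assumes "u < n"
  shows "card {w. (u, w) \<in> A} \<le> B"
proof -
  have "finite E" using edges by (auto simp: edge_list_of_def)
  then have "card {w. (u, w) \<in> A} \<le> card {e \<in> E. u \<in> e}"
    by (intro card_inj_on_le[of "\<lambda>w. {u, w}"]) (auto simp: inj_on_def doubleton_eq_iff arc_iff)
  moreover have "degree E u \<le> B" using deg assms by (simp add: max_degree_le_def)
  ultimately show ?thesis by (simp add: degree_def)
qed

lemma vertex_cover_iff: "vertex_cover n E C \<longleftrightarrow> covers n A C"
proof -
  have "(\<forall>e\<in>E. e \<inter> C \<noteq> {}) \<longleftrightarrow> (\<forall>(u, w)\<in>A. u \<in> C \<or> w \<in> C)"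
  proof
    assume *: "\<forall>e\<in>E. e \<inter> C \<noteq> {}"
    show "\<forall>(u, w)\<in>A. u \<in> C \<or> w \<in> C" using * arc_iff by fastforce
  next
    assume *: "\<forall>(u, w)\<in>A. u \<in> C \<or> w \<in> C"
    show "\<forall>e\<in>E. e \<inter> C \<noteq> {}"
    proof
      fix e assume e: "e \<in> E"
      then obtain u w where "e = {u, w}" using simple by (auto simp: simple_graph_def)
      then show "e \<inter> C \<noteq> {}" using * e arc_iff[of u w] by auto
    qed
  qed
  then show ?thesis by (simp add: vertex_cover_def covers_def)
qed

lemma VCL1_iff:
  assumes "B > 0"
  shows "VCL1 B k n E \<longleftrightarrow> (\<exists>C. covers n A C \<and> B * card C \<le> length es + k * B)"
proof -
  have "real c \<le> real (card E) / real B + real k \<longleftrightarrow> B * c \<le> length es + k * B" for c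
  proof -
    have "real c \<le> real (card E) / real B + real k \<longleftrightarrow> real (B * c) \<le> real (length es + k * B)"
      using assms by (simp add: field_simps card_edges)
    then show ?thesis by (simp only: of_nat_le_iff)
  qed
  then show ?thesis by (simp add: VCL1_def vertex_cover_iff)
qed

lemma VCL1_solve:
  assumes B: "B > 0"
  shows "VCL1 B k n E \<longleftrightarrow>
    B \<le> 1 \<or> (\<exists>x<4 ^ k. B * card (solve n A (4 ^ k) L {} x) \<le> length es + k * B)"
proof
  assume "VCL1 B k n E"
  then obtain S where S: "covers n A S" "B * card S \<le> length es + k * B"
    unfolding VCL1_iff[OF B] by blast
  \<comment> \<open>Doubling the size bound and using \<open>2 m \<le> B * lam\<close> shows that
    the doubled excess is at most \<open>2 k\<close>, the length of the guess.\<close>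
  have "B * (2 * card S) \<le> B * (2 * k + lam n A {})"
    using S(2) card_arcs_le[OF arcs_ok out_degree] card_arcs by (simp add: algebra_simps)
  then have "2 * card (S - {}) \<le> 2 * k + lam n A {}" using B by simp
  from solve_good[OF arcs_ok S(1) _ _ order_refl this, of L]
  obtain y where y: "y < 2 ^ (2 * k)" "card (solve n A (2 ^ (2 * k)) L {} y) \<le> card S"
    by (auto simp: A)
  have four: "(2::nat) ^ (2 * k) = 4 ^ k" by (simp add: power_mult)
  have "B * card (solve n A (4 ^ k) L {} y) \<le> B * card S"
    using y(2) unfolding four by (rule mult_le_mono2)
  then have "B * card (solve n A (4 ^ k) L {} y) \<le> length es + k * B" using S(2) by (rule le_trans)
  moreover have "y < 4 ^ k" using y(1) unfolding four .
  ultimately show "B \<le> 1 \<or> (\<exists>x<4 ^ k. B * card (solve n A (4 ^ k) L {} x) \<le> length es + k * B)"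
    by blast
next
  assume "B \<le> 1 \<or> (\<exists>x<4 ^ k. B * card (solve n A (4 ^ k) L {} x) \<le> length es + k * B)"
  then show "VCL1 B k n E"
  proof
    assume "B \<le> 1"
    then have B1: "B = 1" using B by simp
    have "covers n A (fst ` set es)"
      using edge_props by (force simp: covers_def A L)
    moreover have "card (fst ` set es) \<le> length es"
      using card_image_le[of "set es" fst] card_length[of es] by simp
    ultimately show ?thesis unfolding VCL1_iff[OF B] by (intro exI[of _ "fst ` set es"]) (simp add: B1)
  next
    assume "\<exists>x<4 ^ k. B * card (solve n A (4 ^ k) L {} x) \<le> length es + k * B"
    then obtain x where "B * card (solve n A (4 ^ k) L {} x) \<le> length es + k * B" by blast
    moreover have "covers n A (solve n A (4 ^ k) L {} x)"
      using solve_covers[of "{}" n L A "4 ^ k" x] arcs_ok by (simp add: A arcs_ok_def)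
    ultimately show ?thesis unfolding VCL1_iff[OF B] by blast
  qed
qed

end

text \<open>With at most quadratically many arcs, the bids of one left vertex cost order
  \<open>n ^ 4\<close>; \<open>n\<close> such vertices give one relaxation, and one trial computes
  at most three for each arc, hence the exponent 7.\<close>

lemma trial_time_le:
  assumes "m \<le> n * n"
  shows "trial_time n m \<le> 1841 * (n + 1) ^ 7"
proof -
  define X where "X = n + 1"
  have X1: "1 \<le> X ^ j" for j by (simp add: X_def)
  have mono: "X ^ i \<le> X ^ j" if "i \<le> j" for i j using that by (intro power_increasing) (auto simp: X_def)
  have m: "m \<le> X ^ 2" using assms by (simp add: X_def power2_eq_square)
  have n2: "n * n + 1 \<le> X ^ 2" and nX: "n \<le> X ^ 1" by (simp_all add: X_def power2_eq_square)
  have "(97 * m + 103) * (n * n + 1) \<le> (200 * X ^ 2) * X ^ 2"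
    by (intro mult_mono n2) (use m X1[of 2] in auto)
  also have "\<dots> = 200 * X ^ 4" by (simp add: power_add[symmetric])
  finally have "(97 * m + 103) * (n * n + 1) + 200 \<le> 400 * X ^ 4" using X1[of 4] by linarith
  then have "n * ((97 * m + 103) * (n * n + 1) + 200) \<le> X ^ 1 * (400 * X ^ 4)"
    by (intro mult_mono nX) auto
  also have "\<dots> = 400 * X ^ 5" by (simp add: mult.left_commute flip: power_Suc)
  finally have rt: "relax_time n m \<le> 500 * X ^ 5" using X1[of 5] unfolding relax_time_def by linarith
  have "m * (217 + 3 * relax_time n m) \<le> X ^ 2 * (1717 * X ^ 5)"
    by (intro mult_mono m) (use rt X1[of 5] in auto)
  also have "\<dots> = 1717 * X ^ 7" by (simp add: power_add[symmetric])
  finally have "trial_time n m \<le> 100 + X ^ 1 * 24 + 1717 * X ^ 7"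
    using nX unfolding trial_time_def by linarith
  also have "\<dots> \<le> 1841 * X ^ 7" using X1[of 7] mono[of 1 7] by linarith
  finally show ?thesis by (simp add: X_def)
qed

lemma runs_within_mono:
  assumes "runs_within P xs S out" "S \<le> T"
  shows "runs_within P xs T out"
proof -
  obtain s where "s \<le> S" "halted P ((step P ^^ s) (init xs)) \<and> snd ((step P ^^ s) (init xs)) 0 = out"
    using assms(1) unfolding runs_within_def by blast
  then show ?thesis unfolding runs_within_def using assms(2) by (intro exI[of _ s]) simp
qed

theorem theorem3:
  "\<exists>(P :: instr list) (c :: nat) (d :: nat).
     \<forall>B k n E es.
       B > 0 \<longrightarrow> k > 0 \<longrightarrow> simple_graph n E \<longrightarrow> max_degree_le n E B \<longrightarrow>
       edge_list_of es E \<longrightarrow>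
       runs_within P (encode B k n es) (c * 2 ^ (k * B) * (n + 1) ^ d)
         (if VCL1 B k n E then 1 else 0)"
proof (intro exI allI impI)
  fix B k n :: nat and E es
  assume B: "B > 0" and "k > 0" and G: "simple_graph n E" "edge_list_of es E" "max_degree_le n E B"
  define L where "L = es @ map prod.swap es"
  define A where "A = set L"
  define m where "m = length es"
  define f where "f = snd (init (encode B k n es))"
  note f = encode_input[OF f_def]
  let ?out = "if VCL1 B k n E then 1 else 0 :: nat"
  have pos: "1 \<le> (2::nat) ^ (k * B) * (n + 1) ^ 7" by simp
  show "runs_within program (encode B k n es) (3000 * 2 ^ (k * B) * (n + 1) ^ 7) ?out"
  proof (cases "m = 0")
    case True
    then have "VCL1 B k n E"
      unfolding VCL1_iff[OF G L_def A_def B] by (intro exI[of _ "{}"]) (simp add: covers_def m_def A_def L_def)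
    moreover have "runs_within program (encode B k n es) 2 1"
      by (rule program_zero) (use True f(4) in \<open>simp add: f_def m_def\<close>)
    moreover have "2 \<le> 3000 * 2 ^ (k * B) * (n + 1) ^ 7" using pos by linarith
    ultimately show ?thesis using runs_within_mono[of program _ 2] by presburger
  next
    case False
    let ?T = "300 + m * 150 + k * 38 + (if B \<le> 1 then 0 else 4 ^ k * (trial_time n (2 * m) + 17))"
    have "runs_within program (encode B k n es) (?T + 151) ?out"
    proof (rule program_main[OF f_def])
      fix v :: "nat \<Rightarrow> nat" and a :: "nat \<Rightarrow> nat \<Rightarrow> nat"
      assume "v 0 = f 0" "v 1 = f 1" "v 2 = n + 64 * m" "v 3 = m"
      then have v: "v 0 = B" "v 1 = k" "v 2 = n + 64 * m" "v 3 = m" using f by auto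
      from wp_main[where a = a and t = 0, OF v _ m_def f(5)[folded m_def] L_def A_def arcs_ok[OF G L_def A_def]] False
      show "wp (saved (n + 64 * m) f) main (\<lambda>v' a' t'. v' 0 = ?out \<and> t' \<le> ?T) v a 0"
        unfolding VCL1_solve[OF G L_def A_def B] by (simp add: m_def)
    qed (use f False in \<open>auto simp: m_def\<close>)
    moreover have "?T + 151 \<le> 3000 * 2 ^ (k * B) * (n + 1) ^ 7"
    proof -
      define X where "X = (n + 1) ^ 7"
      define K where "K = (2::nat) ^ (k * B)"
      have m2: "2 * m \<le> n * n" using card_edges_le[OF G L_def A_def] by (simp add: m_def)
      have "n * n \<le> (n + 1) ^ 2" by (simp add: power2_eq_square)
      also have "\<dots> \<le> X" unfolding X_def by (rule power_increasing) auto
      finally have mX: "m \<le> X" using m2 by linarith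
      have X1: "1 \<le> X" and K1: "1 \<le> K" by (simp_all add: X_def K_def)
      \<comment> \<open>The loop computing \<open>4 ^ k\<close> takes time linear in
        \<open>k\<close>, which the exponential factor absorbs.\<close>
      have "k < 2 ^ k" by (rule less_exp)
      also have "(2::nat) ^ k \<le> K" unfolding K_def using B by (intro power_increasing) auto
      finally have kK: "k \<le> K" by simp
      have KX: "K \<le> K * X" "X \<le> K * X" using X1 K1 by simp_all
      have "(if B \<le> 1 then 0 else 4 ^ k * (trial_time n (2 * m) + 17)) \<le> K * (1858 * X)"
      proof (cases "B \<le> 1")
        case False
        have "(4::nat) ^ k = 2 ^ (2 * k)" by (simp add: power_mult)
        also have "\<dots> \<le> K" unfolding K_def using False by (intro power_increasing) auto
        finally have "4 ^ k \<le> K" .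
        moreover have "trial_time n (2 * m) + 17 \<le> 1858 * X"
          using trial_time_le[OF m2] X1 unfolding X_def by linarith
        ultimately have "4 ^ k * (trial_time n (2 * m) + 17) \<le> K * (1858 * X)" by (rule mult_le_mono)
        then show ?thesis using False by simp
      qed simp
      then have "?T + 151 \<le> 451 + m * 150 + k * 38 + 1858 * (K * X)" by simp
      \<comment> \<open>The coefficients sum to 451 + 150 + 38 + 1858 = 2497.\<close>
      also have "\<dots> \<le> 3000 * (K * X)" using KX kK mX K1 X1 by linarith
      finally show ?thesis by (simp add: K_def X_def mult.assoc)
    qed
    ultimately show ?thesis by (rule runs_within_mono)
  qed
qed

end
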